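(* Let $W$ be a Coxeter group with Coxeter system $(W,S)$ and presentation diagram $\Gamma=\Gamma(W,S)$. Then $W$ is 2-ended if and only if $\Gamma$ contains a separating subdiagram $\Gamma_0$ which is the presentation diagram of a finite group, such that $\Gamma-\Gamma_0$ consists of two vertices, each of which is connected to each vertex of $\Gamma_0$ by an edge labeled $2$ (but which are not connected to each other). Equivalently, $W$ is 2-ended if and only if $W=\langle x,y\rangle\times\langle H\rangle$ where $\{x,y\}\cup H=S$, $x$ and $y$ are unrelated, and $\langle H\rangle$ is finite.
   Context: A Coxeter system $(W,S)$ is a group $W$ with generating set $S$ having a presentation $\langle S : (st)^{m(s,t)}\ (s,t\in S,\ m(s,t)<\infty)\rangle$, where $m:S^2\to\{1,2,\ldots,\infty\}$, $m(s,t)=m(t,s)$, and $m(s,t)=1$ iff $s=t$. Generators $s,t\in S$ are unrelated if $m(s,t)=\infty$. The presentation diagram $\Gamma(W,S)$ is the labeled graph with vertex set $S$ and an edge labeled $m(s,t)$ between distinct $s,t\in S$ exactly when $m(s,t)<\infty$. A subdiagram $\Gamma_0$ means an induced subgraph (possibly empty); it is the presentation diagram of the special subgroup of $W$ generated by its vertices. It separates $\Gamma$ if $\Gamma-\Gamma_0$ (the subgraph induced on the vertices not in $\Gamma_0$) has at least two connected components. *)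

theory Defs
  imports "HOL-Algebra.Generated_Groups" "HOL-Library.Extended_Nat"
begin

text \<open>The letter \<open>(a, True)\<close> stands for \<open>a\<close> and \<open>(a, False)\<close> for its formal inverse.\<close>

type_synonym 'a word = "('a \<times> bool) list"

fun word_val :: "('a, 'b) monoid_scheme \<Rightarrow> 'a word \<Rightarrow> 'a" where
  "word_val G [] = \<one>\<^bsub>G\<^esub>"
| "word_val G ((a, b) # w) = (if b then a else inv\<^bsub>G\<^esub> a) \<otimes>\<^bsub>G\<^esub> word_val G w"

text \<open>Equality of two words in the abstract group \<open>\<langle>X | R\<rangle>\<close>, that is, equality in the
  free group on \<open>X\<close> modulo the normal closure of the relators \<open>R\<close>.\<close>

inductive presented_eq :: "'a set \<Rightarrow> 'a word set \<Rightarrow> 'a word \<Rightarrow> 'a word \<Rightarrow> bool"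
  for X :: "'a set" and R :: "'a word set" where
  reflexive: "presented_eq X R u u"
| symmetric: "presented_eq X R u v \<Longrightarrow> presented_eq X R v u"
| transitive: "presented_eq X R u v \<Longrightarrow> presented_eq X R v w \<Longrightarrow> presented_eq X R u w"
| in_context: "presented_eq X R u v \<Longrightarrow> presented_eq X R (p @ u @ q) (p @ v @ q)"
| cancel: "a \<in> X \<Longrightarrow> presented_eq X R [(a, b), (a, \<not> b)] []"
| relator: "r \<in> R \<Longrightarrow> presented_eq X R r []"

text \<open>The canonical map from \<open>\<langle>X | R\<rangle>\<close> to \<open>G\<close> is a well-defined isomorphism.\<close>

definition has_presentation :: "('a, 'b) monoid_scheme \<Rightarrow> 'a set \<Rightarrow> 'a word set \<Rightarrow> bool" where
  "has_presentation G X R \<longleftrightarrow>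
     X \<subseteq> carrier G \<and> generate G X = carrier G \<and>
     (\<forall>u \<in> lists (X \<times> UNIV). \<forall>v \<in> lists (X \<times> UNIV).
        word_val G u = word_val G v \<longleftrightarrow> presented_eq X R u v)"

definition coxeter_relators :: "'a set \<Rightarrow> ('a \<Rightarrow> 'a \<Rightarrow> enat) \<Rightarrow> 'a word set" where
  "coxeter_relators S m =
     {concat (replicate n [(s, True), (t, True)]) | s t n. s \<in> S \<and> t \<in> S \<and> m s t = enat n}"

text \<open>Only the values of \<open>m\<close> on \<open>S \<times> S\<close> matter.\<close>

locale coxeter_system = group W for W (structure) +
  fixes S :: "'a set" and m :: "'a \<Rightarrow> 'a \<Rightarrow> enat"
  assumes m_pos: "s \<in> S \<Longrightarrow> t \<in> S \<Longrightarrow> 1 \<le> m s t"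
    and m_sym: "s \<in> S \<Longrightarrow> t \<in> S \<Longrightarrow> m s t = m t s"
    and m_one_iff: "s \<in> S \<Longrightarrow> t \<in> S \<Longrightarrow> m s t = 1 \<longleftrightarrow> s = t"
    and presentation: "has_presentation W S (coxeter_relators S m)"

definition unrelated :: "('a \<Rightarrow> 'a \<Rightarrow> enat) \<Rightarrow> 'a \<Rightarrow> 'a \<Rightarrow> bool" where
  "unrelated m s t \<longleftrightarrow> m s t = \<infinity>"

text \<open>\<open>E\<close> is meant to be symmetric.\<close>

definition joined :: "('v \<times> 'v) set \<Rightarrow> 'v set \<Rightarrow> ('v \<times> 'v) set" where
  "joined E V = {(u, v). u \<in> V \<and> v \<in> V \<and> (u, v) \<in> (E \<inter> V \<times> V)\<^sup>*}"

record 'v diagram =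
  verts :: "'v set"
  label :: "'v \<Rightarrow> 'v \<Rightarrow> nat option"  \<comment> \<open>\<open>None\<close> means that there is no edge\<close>

definition presentation_diagram :: "'a set \<Rightarrow> ('a \<Rightarrow> 'a \<Rightarrow> enat) \<Rightarrow> 'a diagram" where
  "presentation_diagram S m =
     \<lparr>verts = S,
      label = (\<lambda>s t. if s \<in> S \<and> t \<in> S \<and> s \<noteq> t \<and> m s t \<noteq> \<infinity>
                      then Some (the_enat (m s t)) else None)\<rparr>"

definition induced :: "'v diagram \<Rightarrow> 'v set \<Rightarrow> 'v diagram" where
  "induced \<Gamma> V =
     \<lparr>verts = verts \<Gamma> \<inter> V,
      label = (\<lambda>s t. if s \<in> verts \<Gamma> \<inter> V \<and> t \<in> verts \<Gamma> \<inter> V then label \<Gamma> s t else None)\<rparr>"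

definition subdiagram :: "'v diagram \<Rightarrow> 'v diagram \<Rightarrow> bool" where
  "subdiagram \<Gamma>0 \<Gamma> \<longleftrightarrow> (\<exists>V \<subseteq> verts \<Gamma>. \<Gamma>0 = induced \<Gamma> V)"

definition diagram_diff :: "'v diagram \<Rightarrow> 'v diagram \<Rightarrow> 'v diagram" where
  "diagram_diff \<Gamma> \<Gamma>0 = induced \<Gamma> (verts \<Gamma> - verts \<Gamma>0)"

definition diagram_edges :: "'v diagram \<Rightarrow> ('v \<times> 'v) set" where
  "diagram_edges \<Gamma> = {(s, t). s \<in> verts \<Gamma> \<and> t \<in> verts \<Gamma> \<and> label \<Gamma> s t \<noteq> None}"

definition diagram_components :: "'v diagram \<Rightarrow> 'v set set" where
  "diagram_components \<Gamma> = verts \<Gamma> // joined (diagram_edges \<Gamma>) (verts \<Gamma>)"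

definition separates :: "'v diagram \<Rightarrow> 'v diagram \<Rightarrow> bool" where
  "separates \<Gamma>0 \<Gamma> \<longleftrightarrow>
     (\<exists>C \<in> diagram_components (diagram_diff \<Gamma> \<Gamma>0).
      \<exists>D \<in> diagram_components (diagram_diff \<Gamma> \<Gamma>0). C \<noteq> D)"

text \<open>Letting the group live on the type of the vertices is no restriction for a subdiagram
  of the diagram of some Coxeter system \<open>(W, S)\<close>: it is the diagram of the subgroup of \<open>W\<close>
  generated by its vertices.\<close>

definition diagram_of_finite_group :: "'a diagram \<Rightarrow> bool" where
  "diagram_of_finite_group \<Gamma> \<longleftrightarrow>
     (\<exists>(G :: 'a monoid) m.
        coxeter_system G (verts \<Gamma>) m \<and> \<Gamma> = presentation_diagram (verts \<Gamma>) m \<and>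
        finite (carrier G))"

definition graph_rays :: "('v \<times> 'v) set \<Rightarrow> (nat \<Rightarrow> 'v) set" where
  "graph_rays E = {r. inj r \<and> (\<forall>n. (r n, r (Suc n)) \<in> E)}"

text \<open>Ends as classes of rays; for locally finite graphs these are the Freudenthal ends.\<close>

definition same_end :: "('v \<times> 'v) set \<Rightarrow> ((nat \<Rightarrow> 'v) \<times> (nat \<Rightarrow> 'v)) set" where
  "same_end E =
     {(r, r'). r \<in> graph_rays E \<and> r' \<in> graph_rays E \<and>
        (\<forall>K. finite K \<longrightarrow> (\<exists>N. \<forall>i \<ge> N. \<forall>j \<ge> N. (r i, r' j) \<in> joined E (- K)))}"

definition graph_ends :: "('v \<times> 'v) set \<Rightarrow> (nat \<Rightarrow> 'v) set set" where
  "graph_ends E = graph_rays E // same_end E"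

definition cayley_edges :: "('a, 'b) monoid_scheme \<Rightarrow> 'a set \<Rightarrow> ('a \<times> 'a) set" where
  "cayley_edges G X =
     {(g, h). g \<in> carrier G \<and> h \<in> carrier G \<and>
        (\<exists>x \<in> X. h = g \<otimes>\<^bsub>G\<^esub> x \<or> g = h \<otimes>\<^bsub>G\<^esub> x)}"

text \<open>The ends of a finitely generated group are those of its Cayley graph; their number does
  not depend on the finite generating set. Groups that are not finitely generated are not
  2-ended.\<close>

definition two_ended :: "('a, 'b) monoid_scheme \<Rightarrow> bool" where
  "two_ended G \<longleftrightarrow>
     (\<exists>X. finite X \<and> X \<subseteq> carrier G \<and> generate G X = carrier G \<and>
          card (graph_ends (cayley_edges G X)) = 2)"

definition internal_direct_product ::
    "('a, 'b) monoid_scheme \<Rightarrow> 'a set \<Rightarrow> 'a set \<Rightarrow> bool" where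
  "internal_direct_product G A B \<longleftrightarrow>
     subgroup A G \<and> subgroup B G \<and>
     (\<lambda>(a, b). a \<otimes>\<^bsub>G\<^esub> b) \<in> iso (G\<lparr>carrier := A\<rparr> \<times>\<times> G\<lparr>carrier := B\<rparr>) G"

end

theory Submission
  imports Defs Complex_Main
begin

text \<open>
  Call \<open>A \<subseteq> W\<close> almost invariant if \<open>A\<close> and \<open>A g\<close> differ by a finite set for all \<open>g\<close>. A 2-ended group
  has an almost invariant set that is infinite with infinite complement, but (by Koenig's lemma)
  no three disjoint infinite ones; both statements are independent of the generating set.

  If no finite special subgroup separated the diagram, then the complement of every ball of \<open>W\<close>
  would be connected: a path through \<open>w\<close> can be pushed outwards, since the right descents of \<open>w\<close>
  generate a finite group and \<open>w s\<close>, \<open>w t\<close> are joined around the coset \<open>w \<langle>s, t\<rangle>\<close> when \<open>m s t\<close> is finite.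
  So \<open>S = D \<union> A \<union> B\<close> with \<open>\<langle>D\<rangle>\<close> finite and no edges between \<open>A\<close> and \<open>B\<close>. Distinct cosets of \<open>\<langle>D\<rangle>\<close> in
  \<open>\<langle>D \<union> A\<rangle>\<close> yield disjoint almost invariant half-spaces, so there are at most two of them, which
  forces \<open>A = {a}\<close> with \<open>a\<close> commuting with \<open>D\<close>. That commuting generators have \<open>m = 2\<close>, and that
  unrelated ones have a product of infinite order, is read off the geometric representation.

  Conversely, deleting \<open>x\<close> and \<open>y\<close> from words is a retraction onto \<open>\<langle>H\<rangle>\<close>, which gives the direct
  product, and the Cayley graph of an infinite dihedral group times a finite group is a thickened
  line.
\<close>

section \<open>Words and length in a Coxeter system\<close>

text \<open>Almost invariance quantifies over all group elements, whereas \<open>two_ended\<close>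
  offers one unspecified finite generating set; even finiteness of \<open>S\<close> has to be
  extracted from it. The count of half-spaces uses three cosets at once, the trivial one and those
  of \<open>g\<close> and \<open>h\<close>, so any two elements outside \<open><D>\<close> lie in
  one coset. Taking \<open>a\<close> and \<open>a'\<close> in \<open>A\<close> forces
  \<open>a = a'\<close>; taking \<open>a\<close> and \<open>d a\<close> puts \<open>a d a\<close>
  into \<open><D>\<close>, and a length count identifies it with \<open>d\<close>. The defining
  relations only say that the order of \<open>s t\<close> divides \<open>m s t\<close>; lower bounds
  on this order are the reason for a representation. A diagram of a finite group refers to some
  abstract Coxeter group \<open>G\<close>. Finiteness passes from \<open>G\<close> to
  \<open>W\<close> through a surjection onto the special subgroup; conversely, the special subgroup
  on \<open>H\<close> must itself receive a Coxeter presentation, and the retraction that kills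
  \<open>x\<close> and \<open>y\<close> supplies it. The conditions are then proved in a cycle:
  2-ended, diagram, product.\<close>

declare in_lists_conv_set [simp del]

lemma rev_in_lists [simp]: "rev u \<in> lists A \<longleftrightarrow> u \<in> lists A"
  by (simp add: in_lists_conv_set)

context coxeter_system
begin

definition val :: "'a list \<Rightarrow> 'a" where
  "val u = foldr (\<otimes>) u \<one>"

lemma val_simps [simp]: "val [] = \<one>" "val (s # u) = s \<otimes> val u"
  by (simp_all add: val_def)

lemma S_carrier: "S \<subseteq> carrier W" and generate_S: "generate W S = carrier W"
  using presentation by (simp_all add: has_presentation_def)

lemma S_closed [simp]: "s \<in> S \<Longrightarrow> s \<in> carrier W"
  using S_carrier by blast

lemma lists_S_carrier: "lists S \<subseteq> lists (carrier W)"
  using S_carrier by (rule lists_mono)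

lemma val_closed_carrier: "u \<in> lists (carrier W) \<Longrightarrow> val u \<in> carrier W"
  by (induction u) auto

lemma val_closed [simp]: "u \<in> lists S \<Longrightarrow> val u \<in> carrier W"
  using val_closed_carrier lists_S_carrier by blast

lemma val_append: "u \<in> lists S \<Longrightarrow> v \<in> lists S \<Longrightarrow> val (u @ v) = val u \<otimes> val v"
  by (induction u) (auto simp: m_assoc)

lemma word_val_map: "word_val W (map (\<lambda>s. (s, True)) u) = val u"
  by (induction u) auto

lemma pos_word_lists: "u \<in> lists S \<Longrightarrow> map (\<lambda>s. (s, True)) u \<in> lists (S \<times> UNIV)"
  by (induction u) auto

lemma val_eq_iff:
  assumes "u \<in> lists S" "v \<in> lists S"
  shows "val u = val v \<longleftrightarrow> presented_eq S (coxeter_relators S m)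
    (map (\<lambda>s. (s, True)) u) (map (\<lambda>s. (s, True)) v)"
  using presentation pos_word_lists[OF assms(1)] pos_word_lists[OF assms(2)]
  unfolding has_presentation_def word_val_map[symmetric] by blast

lemma map_concat_replicate: "map f (concat (replicate n l)) = concat (replicate n (map f l))"
  by (induction n) auto

lemma concat_replicate_lists:
  assumes "s \<in> T" "t \<in> T"
  shows "concat (replicate n [s, t]) \<in> lists T"
  using assms by (induction n) auto

lemma val_relator:
  assumes "s \<in> S" "t \<in> S" "m s t = enat n"
  shows "val (concat (replicate n [s, t])) = \<one>"
proof -
  have "concat (replicate n [(s, True), (t, True)]) \<in> coxeter_relators S m"
    using assms by (auto simp: coxeter_relators_def)
  then have "presented_eq S (coxeter_relators S m)
      (map (\<lambda>s. (s, True)) (concat (replicate n [s, t]))) (map (\<lambda>s. (s, True)) [])"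
    by (simp add: map_concat_replicate presented_eq.relator)
  then show ?thesis
    using val_eq_iff[of "concat (replicate n [s, t])" "[]"] concat_replicate_lists[OF assms(1,2), of n]
    by auto
qed

lemma val_concat_replicate:
  assumes "s \<in> S" "t \<in> S"
  shows "val (concat (replicate n [s, t])) = (s \<otimes> t) [^] n"
proof (induction n)
  case (Suc n)
  then show ?case
    using assms nat_pow_Suc2[of "s \<otimes> t" n] by (simp add: m_assoc)
qed simp

lemma relation: "s \<in> S \<Longrightarrow> t \<in> S \<Longrightarrow> m s t = enat n \<Longrightarrow> (s \<otimes> t) [^] n = \<one>"
  using val_relator val_concat_replicate by metis

lemma S_square [simp]: "s \<in> S \<Longrightarrow> s \<otimes> s = \<one>"
  using relation[of s s 1] m_one_iff[of s s] by (simp add: one_enat_def)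

lemma S_inv [simp]: "s \<in> S \<Longrightarrow> inv s = s"
  by (simp add: inv_equality)

lemma S_cancel [simp]: "s \<in> S \<Longrightarrow> g \<in> carrier W \<Longrightarrow> s \<otimes> (s \<otimes> g) = g"
  by (simp flip: m_assoc)

lemma S_cancel_right [simp]: "s \<in> S \<Longrightarrow> g \<in> carrier W \<Longrightarrow> g \<otimes> s \<otimes> s = g"
  by (simp add: m_assoc)

lemma mult_inv_cancel [simp]:
  "g \<in> carrier W \<Longrightarrow> x \<in> carrier W \<Longrightarrow> g \<otimes> (inv g \<otimes> x) = x"
  "g \<in> carrier W \<Longrightarrow> x \<in> carrier W \<Longrightarrow> inv g \<otimes> (g \<otimes> x) = x"
  by (simp_all flip: m_assoc)

lemma val_rev: "u \<in> lists S \<Longrightarrow> val (rev u) = inv (val u)"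
  by (induction u) (auto simp: val_append inv_mult_group)

text \<open>This replaces the universal property of the presentation: \<open>F\<close> is meant to be a
  homomorphism into some monoid.\<close>

lemma word_invariant:
  fixes F :: "'a list \<Rightarrow> 'c"
  assumes ctx: "\<And>p u v q. \<lbrakk>p \<in> lists S; u \<in> lists S; v \<in> lists S; q \<in> lists S; F u = F v\<rbrakk>
      \<Longrightarrow> F (p @ u @ q) = F (p @ v @ q)"
    and square: "\<And>s. s \<in> S \<Longrightarrow> F [s, s] = F []"
    and rel: "\<And>s t n. \<lbrakk>s \<in> S; t \<in> S; m s t = enat n; s \<noteq> t\<rbrakk>
      \<Longrightarrow> F (concat (replicate n [s, t])) = F []"
    and u: "u \<in> lists S" and v: "v \<in> lists S" and eq: "val u = val v"
  shows "F u = F v"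
proof -
  \<comment> \<open>A derivation in \<open>presented_eq\<close> may pass through formal inverses and
    letters outside \<open>S\<close>. Forgetting signs and dropping foreign letters brings every
    intermediate word back to \<open>lists S\<close>; a cancellation becomes
    \<open>[s, s]\<close>.\<close>
  define strip where "strip = (\<lambda>w :: 'a word. filter (\<lambda>s. s \<in> S) (map fst w))"
  have strip_lists: "strip w \<in> lists S" for w
    by (auto simp: strip_def)
  have "presented_eq S (coxeter_relators S m) u' v' \<Longrightarrow> F (strip u') = F (strip v')" for u' v'
  proof (induction rule: presented_eq.induct)
    case (in_context u v p q)
    then show ?case
      using ctx[OF strip_lists[of p] strip_lists[of u] strip_lists[of v] strip_lists[of q]]
      by (simp add: strip_def)
  next
    case (cancel a b)
    then show ?case
      using square by (simp add: strip_def)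
  next
    case (relator r)
    then obtain s t n where r: "r = concat (replicate n [(s, True), (t, True)])"
      and st: "s \<in> S" "t \<in> S" "m s t = enat n"
      by (auto simp: coxeter_relators_def)
    have "strip r = concat (replicate n [s, t])"
      using st concat_replicate_lists[OF st(1,2), of n]
      by (auto simp: strip_def r map_concat_replicate filter_id_conv)
    moreover have "n = 1" if "s = t"
      using st m_one_iff[of s s] that by (simp add: one_enat_def)
    ultimately show ?case
      using rel[OF st] square[OF st(1)] by (cases "s = t") (auto simp: strip_def)
  qed auto
  moreover have "strip (map (\<lambda>s. (s, True)) w) = w" if "w \<in> lists S" for w
    using that by (auto simp: strip_def filter_id_conv comp_def)
  ultimately show ?thesis
    using val_eq_iff[OF u v] eq u v by metis
qed

text \<open>All relators \<open>(s t)^n\<close> have even length; this is the sign character of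
  \<open>W\<close>, expressed on words.\<close>

lemma val_parity:
  assumes "u \<in> lists S" "v \<in> lists S" "val u = val v"
  shows "even (length u) = even (length v)"
proof (rule word_invariant[OF _ _ _ assms, where F = "\<lambda>u. even (length u)"])
  fix s t n
  have "even (length (concat (replicate n [s, t])))"
    by (induction n) auto
  then show "even (length (concat (replicate n [s, t]))) = even (length [])"
    by simp
qed auto

lemma generate_val:
  assumes "T \<subseteq> S"
  shows "generate W T = val ` lists T"
proof -
  have "g \<in> val ` lists T" if "g \<in> generate W T" for g
    using that
  proof (induction)
    case one
    then show ?case by (auto intro!: image_eqI[of _ _ "[]"])
  next
    case (incl h)
    then show ?case using assms by (auto intro!: image_eqI[of _ _ "[h]"])
  next
    case (inv h)
    then have "h \<in> S" using assms by blast
    then show ?case using inv by (auto intro!: image_eqI[of _ _ "[h]"])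
  next
    case (eng h1 h2)
    then obtain u v where uv: "u \<in> lists T" "v \<in> lists T" "h1 = val u" "h2 = val v" by auto
    then have "h1 \<otimes> h2 = val (u @ v)"
      using lists_mono[OF assms] val_append by (metis in_mono)
    then show ?case using uv by (intro image_eqI[of _ _ "u @ v"]) auto
  qed
  moreover have "val u \<in> generate W T" if "u \<in> lists T" for u
    using that by (induction u) (auto intro: generate.intros)
  ultimately show ?thesis by blast
qed

lemma carrier_val: "carrier W = val ` lists S"
  using generate_val[of S] generate_S by simp

lemma generate_subgroup: "T \<subseteq> S \<Longrightarrow> subgroup (generate W T) W"
  using generate_is_subgroup S_carrier by (meson subset_trans)

lemma generate_closed: "T \<subseteq> S \<Longrightarrow> g \<in> generate W T \<Longrightarrow> g \<in> carrier W"
  using generate_subgroup subgroup.mem_carrier by metis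

section \<open>The length function and its parity\<close>

definition len :: "'a \<Rightarrow> nat" where
  "len w = (LEAST n. \<exists>u \<in> lists S. length u = n \<and> val u = w)"

definition reduced :: "'a list \<Rightarrow> bool" where
  "reduced u \<longleftrightarrow> u \<in> lists S \<and> length u = len (val u)"

lemma reduced_lists: "reduced u \<Longrightarrow> u \<in> lists S"
  by (simp add: reduced_def)

lemma len_le: "u \<in> lists S \<Longrightarrow> len (val u) \<le> length u"
  unfolding len_def by (rule Least_le) auto

lemma ex_reduced:
  assumes "w \<in> carrier W"
  shows "\<exists>u. reduced u \<and> val u = w"
proof -
  obtain u where "u \<in> lists S" "val u = w"
    using assms carrier_val by auto
  then have "\<exists>n. \<exists>u \<in> lists S. length u = n \<and> val u = w" by blast
  from LeastI_ex[OF this] show ?thesis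
    unfolding reduced_def len_def by blast
qed

lemma len_one [simp]: "len \<one> = 0"
  using len_le[of "[]"] by simp

lemma len_zero_iff: "w \<in> carrier W \<Longrightarrow> len w = 0 \<longleftrightarrow> w = \<one>"
  using ex_reduced[of w] by (auto simp: reduced_def)

lemma len_mult_le:
  assumes "g \<in> carrier W" "h \<in> carrier W"
  shows "len (g \<otimes> h) \<le> len g + len h"
proof -
  obtain u v where "reduced u" "val u = g" "reduced v" "val v = h"
    using ex_reduced[OF assms(1)] ex_reduced[OF assms(2)] by blast
  then show ?thesis
    using len_le[of "u @ v"] by (simp add: reduced_def val_append)
qed

lemma len_inv [simp]:
  assumes "w \<in> carrier W"
  shows "len (inv w) = len w"
proof -
  have "len (inv g) \<le> len g" if g: "g \<in> carrier W" for g
  proof -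
    obtain u where u: "reduced u" "val u = g" using ex_reduced[OF g] by blast
    then have "len (val (rev u)) \<le> length u" using len_le[of "rev u"] by (simp add: reduced_lists)
    then show ?thesis using u val_rev[of u] by (simp add: reduced_def)
  qed
  from this[of w] this[of "inv w"] show ?thesis using assms by simp
qed

lemma len_val_parity:
  assumes "u \<in> lists S"
  shows "even (len (val u)) \<longleftrightarrow> even (length u)"
  using ex_reduced[of "val u"] val_parity assms by (metis reduced_def val_closed)

lemma len_S [simp]:
  assumes "s \<in> S"
  shows "len s = 1"
  using len_val_parity[of "[s]"] len_le[of "[s]"] assms by (auto simp: le_Suc_eq)

lemma len_parity:
  assumes "g \<in> carrier W" "h \<in> carrier W"
  shows "even (len (g \<otimes> h)) \<longleftrightarrow> (even (len g) \<longleftrightarrow> even (len h))"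
proof -
  obtain u v where "reduced u" "val u = g" "reduced v" "val v = h"
    using ex_reduced[OF assms(1)] ex_reduced[OF assms(2)] by blast
  then show ?thesis
    using len_val_parity[of "u @ v"] by (auto simp: reduced_def val_append)
qed

text \<open>A generator changes the length by at most one, and parity rules out no change.\<close>

lemma len_S_mult:
  assumes "s \<in> S" "w \<in> carrier W"
  shows "len (s \<otimes> w) = Suc (len w) \<or> len w = Suc (len (s \<otimes> w))"
proof -
  have "len (s \<otimes> w) \<le> Suc (len w)" "len w \<le> Suc (len (s \<otimes> w))"
    using len_mult_le[of s w] len_mult_le[of s "s \<otimes> w"] assms by auto
  moreover have "len (s \<otimes> w) \<noteq> len w"
    using len_parity[of s w] assms by auto
  ultimately show ?thesis by linarith
qed

lemma len_mult_S:
  assumes "s \<in> S" "w \<in> carrier W"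
  shows "len (w \<otimes> s) = Suc (len w) \<or> len w = Suc (len (w \<otimes> s))"
  using len_S_mult[of s "inv w"] len_inv[of "w \<otimes> s"] assms by (simp add: inv_mult_group)

lemma finite_ball:
  assumes "finite S"
  shows "finite {w \<in> carrier W. len w \<le> n}"
proof (rule finite_subset)
  show "finite (val ` {u. set u \<subseteq> S \<and> length u \<le> n})"
    using assms by (intro finite_imageI finite_lists_length_le)
  show "{w \<in> carrier W. len w \<le> n} \<subseteq> val ` {u. set u \<subseteq> S \<and> length u \<le> n}"
  proof
    fix w assume "w \<in> {w \<in> carrier W. len w \<le> n}"
    moreover then obtain u where "reduced u" "val u = w"
      using ex_reduced by blast
    ultimately show "w \<in> val ` {u. set u \<subseteq> S \<and> length u \<le> n}"
      by (intro image_eqI[of _ _ u]) (auto simp: reduced_def)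
  qed
qed

section \<open>The exchange condition\<close>

text \<open>The key point, due to Tits: the parity of the multiplicity of a reflection in \<open>refls u\<close> depends
  only on \<open>val u\<close>.\<close>

primrec refls :: "'a list \<Rightarrow> 'a list" where
  "refls [] = []"
| "refls (s # u) = s # map (\<lambda>t. s \<otimes> t \<otimes> s) (refls u)"

lemma refls_closed: "u \<in> lists S \<Longrightarrow> t \<in> set (refls u) \<Longrightarrow> t \<in> carrier W"
  by (induction u arbitrary: t) auto

lemma refls_append:
  assumes "u \<in> lists S" "v \<in> lists S"
  shows "refls (u @ v) = refls u @ map (\<lambda>t. val u \<otimes> t \<otimes> inv (val u)) (refls v)"
  using assms
proof (induction u)
  case Nil
  have "map (\<lambda>t. \<one> \<otimes> t \<otimes> inv \<one>) (refls v) = refls v"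
    using refls_closed[OF assms(2)] by (intro map_idI) simp
  then show ?case by simp
next
  case (Cons s u)
  then show ?case
    using refls_closed[OF assms(2)] by (simp add: inv_mult_group m_assoc)
qed

lemma count_list_conj:
  assumes "g \<in> carrier W" "t \<in> carrier W" "set l \<subseteq> carrier W"
  shows "count_list (map (\<lambda>t. g \<otimes> t \<otimes> inv g) l) t = count_list l (inv g \<otimes> t \<otimes> g)"
  using assms(3)
proof (induction l)
  case (Cons a l)
  have "g \<otimes> a \<otimes> inv g = t \<longleftrightarrow> a = inv g \<otimes> t \<otimes> g"
  proof
    assume "g \<otimes> a \<otimes> inv g = t"
    then have t: "t = g \<otimes> a \<otimes> inv g" ..
    show "a = inv g \<otimes> t \<otimes> g"
      using assms(1) Cons.prems by (simp add: t m_assoc)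
  next
    assume a: "a = inv g \<otimes> t \<otimes> g"
    show "g \<otimes> a \<otimes> inv g = t"
      using assms(1,2) by (simp add: a m_assoc)
  qed
  then show ?case using Cons by auto
qed auto

text \<open>A pair \<open>s t\<close> in front conjugates the later reflections by
  \<open>s t\<close>, which raises their exponent by 2. Once \<open>(s t)^n = 1\<close>, the list
  has period \<open>n\<close>, so every reflection occurs in it an even number of times.\<close>

lemma refls_alternating:
  assumes "s \<in> S" "t \<in> S"
  shows "refls (concat (replicate n [s, t])) = map (\<lambda>j. (s \<otimes> t) [^] j \<otimes> s) [0..<2 * n]"
proof (induction n)
  case (Suc n)
  let ?p = "s \<otimes> t" and ?w = "concat (replicate n [s, t])"
  have p: "?p \<in> carrier W" "inv ?p = t \<otimes> s"
    using assms by (auto simp: inv_mult_group)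
  have shift: "?p \<otimes> (?p [^] j \<otimes> s) \<otimes> inv ?p = ?p [^] (j + 2) \<otimes> s" for j :: nat
  proof -
    have "?p [^] (j + 2) \<otimes> s = ?p [^] Suc j \<otimes> ?p \<otimes> s" by simp
    also have "\<dots> = ?p \<otimes> ?p [^] j \<otimes> (s \<otimes> (t \<otimes> s))"
      using assms by (simp only: nat_pow_Suc2[OF p(1)]) (simp add: m_assoc)
    finally show ?thesis using assms p by (simp add: m_assoc)
  qed
  have "refls (concat (replicate (Suc n) [s, t])) = refls ([s, t] @ ?w)" by simp
  also have "\<dots> = [s, s \<otimes> t \<otimes> s] @ map (\<lambda>g. ?p \<otimes> g \<otimes> inv ?p) (refls ?w)"
    using assms concat_replicate_lists[OF assms, of n] by (subst refls_append) auto
  also have "map (\<lambda>g. ?p \<otimes> g \<otimes> inv ?p) (refls ?w) = map (\<lambda>j. ?p [^] (j + 2) \<otimes> s) [0..<2 * n]"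
    by (simp only: Suc.IH map_map comp_def shift)
  also have "\<dots> = map (\<lambda>j. ?p [^] j \<otimes> s) [2..<2 * n + 2]"
    by (rule nth_equalityI) (auto simp del: upt_Suc nat_pow_Suc)
  also have "[s, s \<otimes> t \<otimes> s] = map (\<lambda>j. ?p [^] j \<otimes> s) [0, 1 :: nat]"
    using assms by simp
  also have "map (\<lambda>j. ?p [^] j \<otimes> s) [0, 1 :: nat] @ map (\<lambda>j. ?p [^] j \<otimes> s) [2..<2 * n + 2]
      = map (\<lambda>j. ?p [^] j \<otimes> s) [0..<2 * Suc n]"
    by (simp add: upt_conv_Cons numeral_2_eq_2 del: upt_Suc)
  finally show ?case .
qed simp

lemma refls_parity:
  assumes "u \<in> lists S" "v \<in> lists S" "val u = val v" "t \<in> carrier W"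
  shows "odd (count_list (refls u) t) = odd (count_list (refls v) t)"
proof -
  \<comment> \<open>Parity alone does not control concatenation: the reflections of a right context
    are conjugated by the value of the word before it. Pairing the parity function with
    \<open>val\<close> repairs this.\<close>
  let ?F = "\<lambda>u. (val u, \<lambda>t. t \<in> carrier W \<and> odd (count_list (refls u) t))"
  have "?F u = ?F v"
  proof (rule word_invariant[OF _ _ _ assms(1-3), where F = ?F])
    fix p u v q
    assume l: "p \<in> lists S" "u \<in> lists S" "v \<in> lists S" "q \<in> lists S" and "?F u = ?F v"
    then have val: "val u = val v"
      and odd: "\<And>t. t \<in> carrier W \<Longrightarrow> odd (count_list (refls u) t) = odd (count_list (refls v) t)"
      by (auto simp: fun_eq_iff)
    have sub: "set (refls w) \<subseteq> carrier W" if "w \<in> lists S" for w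
      using refls_closed that by blast
    have "odd (count_list (refls (p @ u @ q)) t) = odd (count_list (refls (p @ v @ q)) t)"
      if "t \<in> carrier W" for t
    proof -
      have a: "inv (val p) \<otimes> t \<otimes> val p \<in> carrier W"
        using that l by simp
      have *: "count_list (refls (p @ w @ q)) t = count_list (refls p) t
          + (count_list (refls w) (inv (val p) \<otimes> t \<otimes> val p)
            + count_list (map (\<lambda>t. val w \<otimes> t \<otimes> inv (val w)) (refls q)) (inv (val p) \<otimes> t \<otimes> val p))"
        if "w \<in> lists S" for w
      proof -
        have wq: "w @ q \<in> lists S" using that l by auto
        then show ?thesis
          using that l \<open>t \<in> carrier W\<close> sub[OF wq]
          by (simp add: refls_append[OF l(1) wq] count_list_conj[OF val_closed[OF l(1)] _ sub[OF wq]])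
            (simp add: refls_append)
      qed
      show ?thesis
        unfolding *[OF l(2)] *[OF l(3)] using odd[OF a] val by simp
    qed
    then show "?F (p @ u @ q) = ?F (p @ v @ q)"
      using l val by (auto simp: val_append fun_eq_iff)
  next
    fix s assume "s \<in> S"
    then show "?F [s, s] = ?F []"
      by auto
  next
    fix s t n assume st: "s \<in> S" "t \<in> S" "m s t = enat n"
    let ?f = "\<lambda>j. (s \<otimes> t) [^] j \<otimes> s"
    have "?f (j + n) = ?f j" for j
      using relation[OF st] st by (simp flip: nat_pow_mult)
    then have "map ?f [n..<n + n] = map ?f [0..<n]"
      by (intro nth_equalityI) (auto simp: add.commute)
    moreover have "[0..<2 * n] = [0..<n] @ [n..<n + n]"
      using upt_add_eq_append[of 0 n n] by (simp add: mult_2)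
    ultimately have "refls (concat (replicate n [s, t])) = map ?f [0..<n] @ map ?f [0..<n]"
      using refls_alternating[OF st(1,2), of n] by simp
    then show "?F (concat (replicate n [s, t])) = ?F []"
      using val_relator[OF st] by (simp add: fun_eq_iff)
  qed
  then show ?thesis
    using assms(4) by (auto simp: fun_eq_iff)
qed

text \<open>An entry of \<open>refls u\<close> is \<open>p a p^-1\<close> for a prefix
  \<open>p\<close> of \<open>u\<close> followed by the letter \<open>a\<close>, so multiplying by it
  on the left removes that \<open>a\<close>.\<close>

lemma refls_delete:
  assumes "u \<in> lists S" "t \<in> set (refls u)"
  shows "\<exists>p a q. u = p @ a # q \<and> t \<otimes> val u = val (p @ q)"
  using assms
proof (induction u arbitrary: t rule: list.induct)
  case (Cons s u)
  have s: "s \<in> S" and uS: "u \<in> lists S" using Cons.prems by auto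
  show ?case
  proof (cases "t = s")
    case True
    then have "s # u = [] @ s # u \<and> t \<otimes> val (s # u) = val ([] @ u)"
      using s uS by simp
    then show ?thesis by blast
  next
    case False
    then obtain t' where t': "t' \<in> set (refls u)" "t = s \<otimes> t' \<otimes> s"
      using Cons.prems by auto
    then obtain p a q where u: "u = p @ a # q" and del: "t' \<otimes> val u = val (p @ q)"
      using Cons.IH[OF uS] by blast
    have "t \<otimes> val (s # u) = s \<otimes> (t' \<otimes> val u)"
      using s uS t' refls_closed[OF uS t'(1)] by (simp add: m_assoc)
    then have "s # u = (s # p) @ a # q \<and> t \<otimes> val (s # u) = val ((s # p) @ q)"
      using u del by simp
    then show ?thesis by blast
  qed
qed simp

theorem exchange:
  assumes u: "u \<in> lists S" and s: "s \<in> S" and less: "len (s \<otimes> val u) < len (val u)"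
  shows "\<exists>p a q. u = p @ a # q \<and> s \<otimes> val u = val (p @ q)"
proof -
  obtain v where v: "reduced v" "val v = s \<otimes> val u"
    using ex_reduced[of "s \<otimes> val u"] u s by auto
  \<comment> \<open>Otherwise deleting a letter of \<open>v\<close> would give a word for
    \<open>val u\<close> shorter than \<open>len (s u)\<close>, which is below
    \<open>len (val u)\<close>. So \<open>s\<close> is listed exactly once for \<open>s # v\<close>,
    and by parity at least once for \<open>u\<close>, be \<open>u\<close> reduced or not.\<close>
  have "s \<notin> set (refls v)"
  proof
    assume "s \<in> set (refls v)"
    then obtain p a q where "v = p @ a # q" "s \<otimes> val v = val (p @ q)"
      using refls_delete v reduced_lists by blast
    then have "val u = val (p @ q)" "p @ q \<in> lists S" "length (p @ q) < length v"
      using v u s reduced_lists[OF v(1)] by auto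
    then show False
      using len_le[of "p @ q"] less v by (simp add: reduced_def)
  qed
  then have "count_list (refls v) s = 0"
    using count_list_0_iff by fast
  then have "count_list (map (\<lambda>t. s \<otimes> t \<otimes> s) (refls v)) s = 0"
    using count_list_conj[of s s "refls v"] refls_closed[OF reduced_lists[OF v(1)]] s by auto
  then have "odd (count_list (refls (s # v)) s)" by simp
  moreover have "val (s # v) = val u" "s # v \<in> lists S"
    using v s u reduced_lists by auto
  ultimately have "odd (count_list (refls u) s)"
    using refls_parity[of "s # v" u s] u s by auto
  then have "s \<in> set (refls u)"
    by (metis count_notin even_zero)
  then show ?thesis
    using refls_delete u by blast
qed


section \<open>Special subgroups and coset representatives\<close>

lemma reduced_word:
  assumes "w \<in> carrier W"
  obtains u where "reduced u" "val u = w"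
  using ex_reduced[OF assms] by blast

lemma reduced_tl:
  assumes "reduced (s # u)"
  shows "reduced u"
proof -
  have u: "s \<in> S" "u \<in> lists S" using assms by (auto simp: reduced_def)
  then have "len (val (s # u)) \<le> Suc (len (val u))"
    using len_mult_le[of s "val u"] by simp
  then show ?thesis
    using assms len_le[OF u(2)] u by (simp add: reduced_def)
qed

text \<open>By the exchange condition a non-reduced word over \<open>T\<close> can be shortened by deleting letters.\<close>

lemma reduced_word_over:
  assumes T: "T \<subseteq> S" and w: "w \<in> generate W T"
  obtains u where "reduced u" "u \<in> lists T" "val u = w"
proof -
  have "\<exists>v \<in> lists T. reduced v \<and> val v = val u" if "u \<in> lists T" for u
    using that
  proof (induction u rule: list.induct)
    case Nil
    then show ?case by (intro bexI[of _ "[]"]) (auto simp: reduced_def)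
  next
    case (Cons t u)
    then have t: "t \<in> T" "t \<in> S" and "u \<in> lists T" using T by auto
    then obtain v where v: "v \<in> lists T" "reduced v" "val v = val u"
      using Cons.IH by blast
    have vS: "v \<in> lists S" using v reduced_lists by blast
    show ?case
    proof (cases "reduced (t # v)")
      case True
      then show ?thesis using t v by (intro bexI[of _ "t # v"]) auto
    next
      case False
      then have len: "Suc (len (t \<otimes> val v)) = len (val v)"
        using len_S_mult[of t "val v"] val_closed[OF vS] t v vS by (auto simp: reduced_def)
      then obtain p a q where paq: "v = p @ a # q" "t \<otimes> val v = val (p @ q)"
        using exchange[OF vS t(2)] by auto
      moreover have "reduced (p @ q)"
        using paq len vS v by (auto simp: reduced_def)
      ultimately show ?thesis
        using v by (intro bexI[of _ "p @ q"]) auto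
    qed
  qed
  then show ?thesis
    using w that unfolding generate_val[OF T] by (metis imageE)
qed

lemma generate_Int_S:
  assumes "T \<subseteq> S" "s \<in> S" "s \<in> generate W T"
  shows "s \<in> T"
proof -
  obtain u where u: "reduced u" "u \<in> lists T" "val u = s"
    using reduced_word_over[OF assms(1,3)] .
  then have "length u = 1" using len_S[OF assms(2)] by (simp add: reduced_def)
  then obtain t where "u = [t]" by (metis One_nat_def length_0_conv length_Suc_conv)
  then show ?thesis using u assms(1) by auto
qed

text \<open>Each element of \<open>X\<close> uses finitely many letters. Together these letters
  generate \<open>W\<close>, and a generator lying in \<open><T>\<close> belongs to
  \<open>T\<close>, so they exhaust \<open>S\<close>. This is how \<open>two_ended\<close> yields a
  finite \<open>S\<close>.\<close>

lemma finite_generators: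
  assumes "finite X" "generate W X = carrier W"
  shows "finite S"
proof -
  have "X \<subseteq> carrier W" using assms(2) generate.incl by (metis subsetI)
  then have "\<exists>u. u \<in> lists S \<and> val u = x" if "x \<in> X" for x
    using that carrier_val by (metis imageE subsetD)
  then obtain f where f: "\<And>x. x \<in> X \<Longrightarrow> f x \<in> lists S \<and> val (f x) = x"
    by metis
  define T where "T = (\<Union>x \<in> X. set (f x))"
  have T: "T \<subseteq> S" "finite T"
    using f assms(1) by (fastforce simp: T_def in_lists_conv_set)+
  have "x \<in> generate W T" if "x \<in> X" for x
    using that f[OF that] unfolding generate_val[OF T(1)]
    by (intro image_eqI[of _ _ "f x"]) (auto simp: T_def in_lists_conv_set)
  then have "X \<subseteq> generate W T" by blast
  then have "generate W X \<subseteq> generate W T"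
    using generate_subgroup_incl generate_subgroup[OF T(1)] by blast
  then have "S \<subseteq> T"
    using generate_Int_S[OF T(1)] assms(2) S_carrier by blast
  then show ?thesis using T finite_subset by blast
qed

text \<open>Shortest representatives of the cosets \<open><T> v\<close>, tested on the generators in
  \<open>T\<close> only; by \<open>left_min_iff\<close> this local test gives additivity of length
  over all of \<open><T>\<close>.\<close>

definition left_min :: "'a set \<Rightarrow> 'a \<Rightarrow> bool" where
  "left_min T v \<longleftrightarrow> v \<in> carrier W \<and> (\<forall>t \<in> T. len (t \<otimes> v) = Suc (len v))"

text \<open>A letter exchanged on prepending \<open>t\<close> would lie in \<open>u\<close>, against
  \<open>t # u\<close> being reduced, or in \<open>v\<close>, and then \<open>u^-1 t u\<close> would
  shorten \<open>v\<close> although \<open>v\<close> is shortest in its coset.\<close>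

lemma left_min_exchange:
  assumes u: "reduced u" "u \<in> lists T" and v: "reduced v" and T: "T \<subseteq> S"
    and min: "\<And>g. g \<in> generate W T \<Longrightarrow> len (val v) \<le> len (g \<otimes> val v)"
  shows "reduced (u @ v)"
  using u
proof (induction u rule: list.induct)
  case Nil
  then show ?case using v by simp
next
  case (Cons t u)
  then have t: "t \<in> S" "t \<in> T" and uT: "u \<in> lists T" and uS: "u \<in> lists S" and vS: "v \<in> lists S"
    using T v reduced_lists by auto
  have uv: "reduced (u @ v)" using Cons.IH Cons.prems reduced_tl uT by blast
  show ?case
  proof (rule ccontr)
    assume "\<not> reduced ((t # u) @ v)"
    then have "len (t \<otimes> val (u @ v)) < len (val (u @ v))"
      using len_S_mult[of t "val (u @ v)"] uv t uS vS by (auto simp: reduced_def)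
    then obtain p a q where paq: "u @ v = p @ a # q" "t \<otimes> val (u @ v) = val (p @ q)"
      using exchange[of "u @ v" t] uS vS t by auto
    then consider r where "u = p @ a # r" "q = r @ v" | r where "p = u @ r" "v = r @ a # q"
      by (auto simp: append_eq_append_conv2 append_eq_Cons_conv Cons_eq_append_conv)
    then show False
    proof cases
      case 1
      then have pr: "p \<in> lists S" "r \<in> lists S" using uS by auto
      have "(t \<otimes> val u) \<otimes> val v = val (p @ r) \<otimes> val v"
        using paq 1 t uS vS pr by (simp add: val_append m_assoc)
      then have "val (t # u) = val (p @ r)"
        using t uS vS pr by simp
      then show False
        using len_le[of "p @ r"] Cons.prems 1 pr by (simp add: reduced_def)
    next
      case 2
      then have r: "r \<in> lists S" "q \<in> lists S" using vS by auto
      let ?g = "inv (val u) \<otimes> t \<otimes> val u"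
      have "val u \<in> generate W T" using uT generate_val[OF T] by blast
      then have "?g \<in> generate W T"
        using t(2) generate_subgroup[OF T] by (meson generate.incl subgroup.m_closed subgroup.m_inv_closed)
      moreover have "?g \<otimes> val v = inv (val u) \<otimes> (t \<otimes> val (u @ v))"
        using t uS vS by (simp add: val_append m_assoc)
      then have "?g \<otimes> val v = inv (val u) \<otimes> (val u \<otimes> val (r @ q))"
        using paq 2 uS r by (simp add: val_append m_assoc)
      then have "?g \<otimes> val v = val (r @ q)"
        using uS r by (simp flip: m_assoc)
      ultimately have "len (val v) \<le> length (r @ q)"
        using min len_le[of "r @ q"] r by (metis append_in_lists_conv order_trans)
      then show False using v 2 by (simp add: reduced_def)
    qed
  qed
qed

text \<open>From left to right, take a shortest element \<open>v0\<close> of the coset, for which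
  lengths add by \<open>left_min_exchange\<close>. If \<open>v = h v0\<close> with \<open>h\<close>
  not \<open>1\<close>, the first letter of a reduced word for \<open>h\<close> shortens
  \<open>v\<close>, against \<open>left_min\<close>.\<close>

lemma left_min_iff:
  assumes T: "T \<subseteq> S" and v: "v \<in> carrier W"
  shows "left_min T v \<longleftrightarrow> (\<forall>g \<in> generate W T. len (g \<otimes> v) = len g + len v)"
proof
  assume "\<forall>g \<in> generate W T. len (g \<otimes> v) = len g + len v"
  then show "left_min T v"
    using v T generate.incl[of _ T W] len_S unfolding left_min_def by (metis plus_1_eq_Suc subsetD)
next
  assume lm: "left_min T v"
  obtain g0 where g0: "g0 \<in> generate W T"
    and "\<forall>g. g \<in> generate W T \<longrightarrow> len (g0 \<otimes> v) \<le> len (g \<otimes> v)"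
    using ex_has_least_nat[of "\<lambda>g. g \<in> generate W T" \<one> "\<lambda>g. len (g \<otimes> v)"] generate.one by metis
  then have min0: "len (g0 \<otimes> v) \<le> len (g \<otimes> v)" if "g \<in> generate W T" for g
    using that by blast
  define v0 where "v0 = g0 \<otimes> v"
  have sub: "subgroup (generate W T) W" using generate_subgroup[OF T] .
  have g0c: "g0 \<in> carrier W" using generate_closed[OF T g0] .
  have v0: "v0 \<in> carrier W" using g0c v by (simp add: v0_def)
  have min: "len v0 \<le> len (g \<otimes> v0)" if "g \<in> generate W T" for g
    using min0[of "g \<otimes> g0"] that g0 g0c v generate_closed[OF T that] subgroup.m_closed[OF sub that g0]
    by (simp add: v0_def m_assoc)
  have add: "len (g \<otimes> v0) = len g + len v0" if g: "g \<in> generate W T" for g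
  proof -
    obtain u where u: "reduced u" "u \<in> lists T" "val u = g" using reduced_word_over[OF T g] .
    obtain x where x: "reduced x" "val x = v0" using reduced_word[OF v0] .
    have "reduced (u @ x)" using left_min_exchange[OF u(1,2) x(1) T] min x by auto
    then show ?thesis
      using u x reduced_lists by (simp add: reduced_def val_append)
  qed
  define h where "h = inv g0"
  have h: "h \<in> generate W T" using g0 sub by (simp add: h_def subgroup.m_inv_closed)
  have hc: "h \<in> carrier W" using generate_closed[OF T h] .
  have v_eq: "v = h \<otimes> v0" using g0c v by (simp add: h_def v0_def flip: m_assoc)
  have "h = \<one>"
  proof -
    obtain u where u: "reduced u" "u \<in> lists T" "val u = h" using reduced_word_over[OF T h] .
    show ?thesis
    proof (cases u)
      case Nil
      then show ?thesis using u by simp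
    next
      case (Cons t r)
      then have t: "t \<in> T" "t \<in> S" "r \<in> lists T" "r \<in> lists S" using u T reduced_lists by auto
      have "t \<otimes> v = val r \<otimes> v0"
        using t v0 by (simp add: v_eq u(3)[symmetric] Cons m_assoc)
      then have "len (t \<otimes> v) \<le> length r + len v0"
        using len_mult_le[of "val r" v0] len_le[of r] t v0 by simp
      moreover have "len v = Suc (length r) + len v0"
        using add[OF h] u Cons v_eq by (simp add: reduced_def)
      ultimately have "len (t \<otimes> v) < len v" by simp
      then show ?thesis using lm t by (auto simp: left_min_def)
    qed
  qed
  then have "v = v0" using v_eq v0 by simp
  then show "\<forall>g \<in> generate W T. len (g \<otimes> v) = len g + len v"
    using add by blast
qed

text \<open>Two representatives of one coset differ by some \<open>g\<close> in \<open><T>\<close>;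
  adding \<open>len g\<close> in both directions gives \<open>len g = 0\<close>.\<close>

lemma left_min_unique:
  assumes T: "T \<subseteq> S" and u: "u \<in> generate W T" "u' \<in> generate W T"
    and v: "left_min T v" "left_min T v'" and eq: "u \<otimes> v = u' \<otimes> v'"
  shows "u = u' \<and> v = v'"
proof -
  have sub: "subgroup (generate W T) W" using generate_subgroup[OF T] .
  have c: "u \<in> carrier W" "u' \<in> carrier W" "v \<in> carrier W" "v' \<in> carrier W"
    using u v generate_closed[OF T] by (auto simp: left_min_def)
  define g where "g = inv u' \<otimes> u"
  have g: "g \<in> generate W T" "g \<in> carrier W"
    using u c sub by (auto simp: g_def subgroup.m_closed subgroup.m_inv_closed)
  have "g \<otimes> v = inv u' \<otimes> (u' \<otimes> v')"
    using c by (simp add: g_def m_assoc eq)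
  then have v': "v' = g \<otimes> v"
    using c by (simp flip: m_assoc)
  then have "v = inv g \<otimes> v'"
    using c g by (simp flip: m_assoc)
  moreover have "inv g \<in> generate W T"
    using g sub by (simp add: subgroup.m_inv_closed)
  ultimately have "len v = len g + len v'"
    using left_min_iff[OF T c(4)] v(2) g by auto
  moreover have "len v' = len g + len v"
    using left_min_iff[OF T c(3)] v(1) g v' by auto
  ultimately have "g = \<one>"
    using len_zero_iff[OF g(2)] by linarith
  then have "v' = v" using v' c by simp
  then show ?thesis using eq c by simp
qed

text \<open>Let \<open>t\<close> shorten \<open>v s\<close>, and exchange in \<open>x @ [s]\<close>
  with \<open>x\<close> reduced for \<open>v\<close>. Deleting a letter of \<open>x\<close> would
  make \<open>t\<close> shorten \<open>v\<close>; so the deleted letter is the final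
  \<open>s\<close>, and \<open>t v s = v\<close>.\<close>

lemma deodhar:
  assumes T: "T \<subseteq> S" and v: "left_min T v" and s: "s \<in> S" and n: "\<not> left_min T (v \<otimes> s)"
  shows "\<exists>t \<in> T. v \<otimes> s = t \<otimes> v \<and> len (v \<otimes> s) = Suc (len v)"
proof -
  have vc: "v \<in> carrier W" using v by (simp add: left_min_def)
  obtain t where t: "t \<in> T" "len (t \<otimes> (v \<otimes> s)) \<noteq> Suc (len (v \<otimes> s))"
    using n s vc by (auto simp: left_min_def)
  have tS: "t \<in> S" using t T by blast
  have tv: "len (t \<otimes> v) = Suc (len v)" using v t by (simp add: left_min_def)
  have less: "Suc (len (t \<otimes> (v \<otimes> s))) = len (v \<otimes> s)"
    using t len_S_mult[of t "v \<otimes> s"] tS s vc by auto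
  have "len (t \<otimes> v) \<le> Suc (len (t \<otimes> (v \<otimes> s)))"
    using len_mult_le[of "t \<otimes> (v \<otimes> s)" s] tS s vc by (simp add: m_assoc)
  then have vs: "len (v \<otimes> s) = Suc (len v)"
    using len_mult_S[of s v] s vc less tv by linarith
  obtain x where x: "reduced x" "val x = v" using reduced_word[OF vc] .
  have xS: "x \<in> lists S" using x reduced_lists by blast
  have xs: "val (x @ [s]) = v \<otimes> s" using x xS s by (simp add: val_append)
  then obtain p a q where paq: "x @ [s] = p @ a # q" "t \<otimes> (v \<otimes> s) = val (p @ q)"
    using exchange[of "x @ [s]" t] less xS s tS by auto
  show ?thesis
  proof (cases q rule: rev_cases)
    case Nil
    then have "t \<otimes> (v \<otimes> s) = v" using paq x by simp
    then have "v \<otimes> s = t \<otimes> v" using S_cancel[OF tS, of "v \<otimes> s"] s vc by simp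
    then show ?thesis using t vs by blast
  next
    case (snoc r b)
    then have r: "x = p @ a # r" "b = s" using paq by auto
    then have pr: "p \<in> lists S" "r \<in> lists S" using xS by auto
    have "t \<otimes> (v \<otimes> s) = val (p @ r) \<otimes> s"
      using paq(2) snoc r pr s by (simp add: val_append m_assoc)
    then have "t \<otimes> v \<otimes> s = val (p @ r) \<otimes> s"
      using tS s vc by (simp add: m_assoc)
    then have "t \<otimes> v = val (p @ r)"
      using tS s vc pr by simp
    then have "len (t \<otimes> v) \<le> length (p @ r)"
      using len_le[of "p @ r"] pr by simp
    then show ?thesis using tv x r by (simp add: reduced_def)
  qed
qed

text \<open>Every reduced word over \<open>T\<close> begins some reduced word for \<open>w\<close>:
  in the induction, the letter exchanged for \<open>t\<close> cannot lie in \<open>u\<close>,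
  because \<open>t # u\<close> is reduced. Hence lengths in \<open><T>\<close> are bounded by
  \<open>len w\<close>, which for finite \<open>S\<close> makes \<open><T>\<close> finite.\<close>

lemma left_descents_split:
  assumes T: "T \<subseteq> S" and w: "w \<in> carrier W" and desc: "\<And>t. t \<in> T \<Longrightarrow> len (t \<otimes> w) < len w"
    and g: "g \<in> generate W T"
  shows "len w = len g + len (inv g \<otimes> w)"
proof -
  have "len w = length u + len (inv (val u) \<otimes> w)" if "u \<in> lists T" "reduced u" for u
    using that
  proof (induction u rule: list.induct)
    case Nil
    then show ?case using w by simp
  next
    case (Cons t u)
    then have t: "t \<in> S" "t \<in> T" and uT: "u \<in> lists T" and uS: "u \<in> lists S"
      using T reduced_lists by auto
    have IH: "len w = length u + len (inv (val u) \<otimes> w)"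
      using Cons.IH uT Cons.prems reduced_tl by blast
    obtain z where z: "reduced z" "val z = inv (val u) \<otimes> w"
      using reduced_word[of "inv (val u) \<otimes> w"] uS w by auto
    have zS: "z \<in> lists S" using z reduced_lists by blast
    have w_eq: "val (u @ z) = w"
      using uS zS w z by (simp add: val_append flip: m_assoc)
    obtain p a q where paq: "u @ z = p @ a # q" "t \<otimes> w = val (p @ q)"
      using exchange[of "u @ z" t] desc[OF t(2)] uS zS t w_eq by auto
    then consider r where "u = p @ a # r" "q = r @ z" | r where "p = u @ r" "z = r @ a # q"
      by (auto simp: append_eq_append_conv2 append_eq_Cons_conv Cons_eq_append_conv)
    then show ?case
    proof cases
      case 1
      then have pr: "p \<in> lists S" "r \<in> lists S" using uS by auto
      have "(t \<otimes> val u) \<otimes> val z = val (p @ r) \<otimes> val z"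
        using paq 1 t uS zS pr w_eq by (simp add: val_append m_assoc)
      then have "val (t # u) = val (p @ r)"
        using t uS zS pr by simp
      then show ?thesis
        using len_le[of "p @ r"] Cons.prems 1 pr by (simp add: reduced_def)
    next
      case 2
      then have r: "r \<in> lists S" "q \<in> lists S" using zS by auto
      have "inv (val (t # u)) \<otimes> w = inv (val u) \<otimes> (t \<otimes> w)"
        using t uS w by (simp add: inv_mult_group m_assoc)
      also have "\<dots> = val (r @ q)"
        using paq 2 uS r by (simp add: val_append flip: m_assoc)
      finally have "len (inv (val (t # u)) \<otimes> w) \<le> length (r @ q)"
        using len_le[of "r @ q"] r by simp
      also have "\<dots> < length z" using 2 by simp
      finally have "len (inv (val (t # u)) \<otimes> w) < length z" .
      moreover have "len w = length u + length z" using IH z by (simp add: reduced_def)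
      moreover have "len w \<le> length (t # u) + len (inv (val (t # u)) \<otimes> w)"
      proof -
        have "w = val (t # u) \<otimes> (inv (val (t # u)) \<otimes> w)"
          using t uS w mult_inv_cancel(1)[of "val (t # u)" w] by simp
        then show ?thesis
          using len_mult_le[of "val (t # u)" "inv (val (t # u)) \<otimes> w"] len_le[of "t # u"] t uS w
          by simp
      qed
      ultimately show ?thesis by simp
    qed
  qed
  moreover obtain u where "reduced u" "u \<in> lists T" "val u = g"
    using reduced_word_over[OF T g] .
  ultimately show ?thesis by (metis reduced_def)
qed

lemma finite_left_descents:
  assumes "finite S" "T \<subseteq> S" "w \<in> carrier W" "\<And>t. t \<in> T \<Longrightarrow> len (t \<otimes> w) < len w"
  shows "finite (generate W T)"
proof (rule finite_subset)
  show "generate W T \<subseteq> {g \<in> carrier W. len g \<le> len w}"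
    using left_descents_split[OF assms(2-4)] generate_closed[OF assms(2)]
    by (metis (no_types, lifting) le_add1 mem_Collect_eq subsetI)
  show "finite {g \<in> carrier W. len g \<le> len w}"
    using finite_ball[OF assms(1)] .
qed

section \<open>The geometric representation\<close>

text \<open>Minus twice the Tits form \<open>B s t = - cos (pi / m s t)\<close>, whose value for
  \<open>m s t = \<infinity>\<close> is \<open>-1\<close>.\<close>

definition form :: "'a \<Rightarrow> 'a \<Rightarrow> real" where
  "form s t = (if s = t then -2 else case m s t of enat n \<Rightarrow> 2 * cos (pi / n) | \<infinity> \<Rightarrow> 2)"

text \<open>The contragredient of the geometric representation: \<open>W\<close> acts on all real functions on the
  generators, so that no finiteness of supports is needed.\<close>

definition act :: "'a \<Rightarrow> ('a \<Rightarrow> real) \<Rightarrow> 'a \<Rightarrow> real" where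
  "act s f = (\<lambda>u. f u + form s u * f s)"

primrec rep :: "'a list \<Rightarrow> ('a \<Rightarrow> real) \<Rightarrow> 'a \<Rightarrow> real" where
  "rep [] = id"
| "rep (s # u) = act s \<circ> rep u"

lemma form_same [simp]: "form s s = -2"
  by (simp add: form_def)

lemma form_sym: "s \<in> S \<Longrightarrow> t \<in> S \<Longrightarrow> form s t = form t s"
  using m_sym[of s t] by (simp add: form_def)

lemma rep_append: "rep (u @ v) = rep u \<circ> rep v"
  by (induction u) auto

lemma rep_concat_replicate: "rep (concat (replicate n [s, t])) = (act s \<circ> act t) ^^ n"
  by (induction n) (auto simp: comp_assoc)

lemma sin_recurrence: "2 * cos \<theta> * sin x - sin (x - \<theta>) = sin (x + \<theta>)" for \<theta> x :: real
  by (simp add: sin_add sin_diff)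

text \<open>Up to a part \<open>g\<close> fixed by \<open>s\<close> and \<open>t\<close>, the action
  takes place in the span of \<open>form s\<close> and \<open>form t\<close>. There the two
  coefficients are neighbouring samples of a sinusoid \<open>A\<close> with step
  \<open>\<theta>\<close>, and each reflection replaces the older sample by the next one. So
  \<open>s t\<close> advances the angle by \<open>2 \<theta>\<close>, and \<open>n\<close>
  repetitions advance it by \<open>2 pi\<close>.\<close>

lemma rep_relator:
  assumes st: "s \<in> S" "t \<in> S" and n: "m s t = enat n" and ne: "s \<noteq> t"
  shows "rep (concat (replicate n [s, t])) = id"
proof
  fix f
  define \<theta> where "\<theta> = pi / n"
  define c where "c = 2 * cos \<theta>"
  have c: "form s t = c" "form t s = c"
    using ne n m_sym[OF st] by (auto simp: form_def c_def \<theta>_def)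
  have "n \<noteq> 0" "n \<noteq> 1"
    using m_pos[OF st] m_one_iff[OF st] n ne by (auto simp: one_enat_def)
  then have n2: "2 \<le> n" by simp
  then have "0 < \<theta>" "\<theta> < pi" by (auto simp: \<theta>_def divide_less_eq)
  then have sin: "sin \<theta> \<noteq> 0" using sin_gt_zero by force
  have "4 - c\<^sup>2 = 4 * (sin \<theta>)\<^sup>2"
    by (simp add: c_def power_mult_distrib sin_squared_eq)
  then have det: "4 - c\<^sup>2 \<noteq> 0" using sin by simp
  \<comment> \<open>Chosen so that \<open>g\<close> below vanishes at \<open>s\<close> and
    \<open>t\<close>; the determinant of this linear system is \<open>4 - c^2\<close>.\<close>
  define \<alpha> where "\<alpha> = (2 * f s + c * f t) / (4 - c\<^sup>2)"
  define \<beta> where "\<beta> = (c * f s + 2 * f t) / (4 - c\<^sup>2)"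
  have D: "(4 - c\<^sup>2) * \<alpha> = 2 * f s + c * f t" "(4 - c\<^sup>2) * \<beta> = c * f s + 2 * f t"
    using det by (simp_all add: \<alpha>_def \<beta>_def)
  have "(4 - c\<^sup>2) * (2 * \<alpha> - c * \<beta>) = 2 * ((4 - c\<^sup>2) * \<alpha>) - c * ((4 - c\<^sup>2) * \<beta>)"
    by (simp add: algebra_simps)
  also have "\<dots> = (4 - c\<^sup>2) * f s"
    unfolding D by (simp add: algebra_simps power2_eq_square)
  finally have "f s = 2 * \<alpha> - c * \<beta>" using det by simp
  moreover have "(4 - c\<^sup>2) * (2 * \<beta> - c * \<alpha>) = 2 * ((4 - c\<^sup>2) * \<beta>) - c * ((4 - c\<^sup>2) * \<alpha>)"
    by (simp add: algebra_simps)
  then have "(4 - c\<^sup>2) * (2 * \<beta> - c * \<alpha>) = (4 - c\<^sup>2) * f t"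
    unfolding D by (simp add: algebra_simps power2_eq_square)
  then have "f t = 2 * \<beta> - c * \<alpha>" using det by simp
  ultimately have \<alpha>\<beta>: "f s = 2 * \<alpha> - c * \<beta>" "f t = 2 * \<beta> - c * \<alpha>" by auto
  define g where "g = (\<lambda>u. f u + \<alpha> * form s u + \<beta> * form t u)"
  have g0: "g s = 0" "g t = 0"
    using \<alpha>\<beta> c by (simp_all add: g_def algebra_simps)
  define F where "F = (\<lambda>a b u. g u + a * form s u + b * form t u)"
  have act_s: "act s (F a b) = F (c * b - a) b" for a b
    using c g0 by (auto simp: F_def act_def algebra_simps)
  have act_t: "act t (F a b) = F a (c * a - b)" for a b
    using c g0 by (auto simp: F_def act_def algebra_simps)
  \<comment> \<open>With these amplitudes \<open>A 0 = - \<alpha>\<close> and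
    \<open>A (- \<theta>) = - \<beta>\<close>, so that the orbit starts at \<open>f\<close>.\<close>
  define p where "p = - \<alpha> / sin \<theta>"
  define q where "q = \<beta> / sin \<theta>"
  define A where "A = (\<lambda>x. p * sin (x + \<theta>) + q * sin x)"
  have rec: "c * A x - A (x - \<theta>) = A (x + \<theta>)" for x
  proof -
    have r: "c * sin (x + \<theta>) - sin x = sin (x + \<theta> + \<theta>)" "c * sin x - sin (x - \<theta>) = sin (x + \<theta>)"
      using sin_recurrence[of \<theta> "x + \<theta>"] sin_recurrence[of \<theta> x] by (simp_all add: c_def)
    have "c * A x - A (x - \<theta>) = p * (c * sin (x + \<theta>) - sin x) + q * (c * sin x - sin (x - \<theta>))"
      by (simp add: A_def algebra_simps)
    then show ?thesis unfolding r by (simp add: A_def)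
  qed
  have pow: "((act s \<circ> act t) ^^ j) (F (A 0) (A (- \<theta>))) = F (A (2 * real j * \<theta>)) (A (2 * real j * \<theta> - \<theta>))" for j :: nat
  proof (induction j)
    case (Suc j)
    have "((act s \<circ> act t) ^^ Suc j) (F (A 0) (A (- \<theta>)))
        = act s (act t (F (A (2 * real j * \<theta>)) (A (2 * real j * \<theta> - \<theta>))))"
      by (simp only: funpow.simps o_apply Suc.IH)
    also have "\<dots> = F (A (2 * real j * \<theta> + \<theta> + \<theta>)) (A (2 * real j * \<theta> + \<theta>))"
      using rec[of "2 * real j * \<theta>"] rec[of "2 * real j * \<theta> + \<theta>"] by (simp add: act_s act_t)
    also have "2 * real j * \<theta> + \<theta> + \<theta> = 2 * real (Suc j) * \<theta>"
      by (simp add: algebra_simps)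
    also have "2 * real j * \<theta> + \<theta> = 2 * real (Suc j) * \<theta> - \<theta>"
      by (simp add: algebra_simps)
    finally show ?case .
  qed simp
  have per: "A (x + 2 * real n * \<theta>) = A x" for x
  proof -
    have e: "2 * real n * \<theta> = 2 * pi" using n2 by (simp add: \<theta>_def)
    have "sin (x + 2 * real n * \<theta>) = sin x" "sin (x + 2 * real n * \<theta> + \<theta>) = sin (x + \<theta>)"
      unfolding e using sin_periodic[of x] sin_periodic[of "x + \<theta>"] by (simp_all add: add_ac)
    then show ?thesis by (simp add: A_def)
  qed
  have start: "F (A 0) (A (- \<theta>)) = f"
    using sin by (auto simp: F_def A_def p_def q_def g_def)
  show "rep (concat (replicate n [s, t])) f = id f"
    using pow[of n] per[of 0] per[of "- \<theta>"] start by (simp add: rep_concat_replicate)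
qed

lemma rep_val:
  assumes "u \<in> lists S" "v \<in> lists S" "val u = val v"
  shows "rep u = rep v"
proof (rule word_invariant[OF _ _ _ assms])
  fix s assume "s \<in> S"
  show "rep [s, s] = rep []"
    by (auto simp: act_def fun_eq_iff algebra_simps)
next
  fix s t n assume "s \<in> S" "t \<in> S" "m s t = enat n" "s \<noteq> t"
  then show "rep (concat (replicate n [s, t])) = rep []"
    by (simp add: rep_relator)
qed (simp add: rep_append)

text \<open>Applied to the indicator function of \<open>t\<close> and read off at \<open>s\<close>,
  the words \<open>s t\<close> and \<open>t s\<close> give \<open>- form t s\<close> and
  \<open>form t s\<close>. So the form vanishes, and \<open>cos (pi / n) = 0\<close> leaves only
  \<open>n = 2\<close>.\<close>

lemma commute_imp_m_two:
  assumes st: "s \<in> S" "t \<in> S" "s \<noteq> t" and comm: "s \<otimes> t = t \<otimes> s"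
  shows "m s t = 2"
proof -
  define f where "f = (\<lambda>u. if u = t then 1 else 0 :: real)"
  have "rep [s, t] f s = rep [t, s] f s"
    using rep_val[of "[s, t]" "[t, s]"] st comm by simp
  then have "form t s = 0"
    using st by (simp add: act_def f_def)
  then have "form s t = 0"
    using form_sym st by simp
  then obtain n where n: "m s t = enat n" "cos (pi / n) = 0"
    using st by (auto simp: form_def split: enat.splits)
  have "n \<noteq> 0" "n \<noteq> 1"
    using m_pos[OF st(1,2)] m_one_iff[OF st(1,2)] n st by (auto simp: one_enat_def)
  then have "2 \<le> n" by simp
  have "0 \<le> pi / real n" by simp
  moreover have "pi / real n \<le> pi"
    using \<open>2 \<le> n\<close> by (simp add: divide_le_eq)
  ultimately have "pi / real n = pi / 2"
    using n(2) cos_inj_pi[of "pi / real n" "pi / 2"] by simp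
  then have "n = 2"
    using \<open>2 \<le> n\<close> by (simp add: field_simps)
  then show ?thesis using n by (simp add: numeral_eq_enat)
qed

text \<open>With \<open>form s t = 2\<close> the product acts unipotently: starting from the
  indicator function of \<open>s\<close>, the value at \<open>t\<close> grows by 2 with each
  step.\<close>

lemma unrelated_infinite_order:
  assumes st: "s \<in> S" "t \<in> S" and inf: "m s t = \<infinity>" and n: "0 < n"
  shows "(s \<otimes> t) [^] (n :: nat) \<noteq> \<one>"
proof
  assume eq: "(s \<otimes> t) [^] n = \<one>"
  have ne: "s \<noteq> t" using inf m_one_iff[OF st] by auto
  have form: "form s t = 2" "form t s = 2"
    using inf ne m_sym[OF st] by (auto simp: form_def)
  define f where "f = (\<lambda>u. if u = s then 1 else 0 :: real)"
  have "((act s \<circ> act t) ^^ j) f s = 1 - 2 * real j \<and> ((act s \<circ> act t) ^^ j) f t = 2 * real j" for j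
  proof (induction j)
    case 0
    then show ?case using ne by (simp add: f_def)
  next
    case (Suc j)
    then show ?case by (simp add: act_def form algebra_simps)
  qed
  then have "rep (concat (replicate n [s, t])) f t = 2 * real n"
    by (simp add: rep_concat_replicate)
  moreover have "rep (concat (replicate n [s, t])) = rep []"
    using rep_val[of "concat (replicate n [s, t])" "[]"] concat_replicate_lists[OF st, of n]
      val_concat_replicate[OF st, of n] eq by simp
  ultimately show False using n ne by (simp add: f_def)
qed

end

section \<open>Ends and almost invariant sets\<close>

text \<open>The ray keeps to vertices with infinitely many descendants along \<open>Q\<close>, whose
  steps raise the level \<open>d\<close> by exactly one. The conclusion \<open>d (r n) = n\<close>
  later makes the ray injective.\<close>

lemma koenig:
  fixes V :: "'v set" and R :: "('v \<times> 'v) set" and d :: "'v \<Rightarrow> nat"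
  assumes V: "infinite V" and roots: "finite {v \<in> V. d v = 0}"
    and branching: "\<And>v. v \<in> V \<Longrightarrow> finite (R `` {v})"
    and parent: "\<And>v n. v \<in> V \<Longrightarrow> d v = Suc n \<Longrightarrow> \<exists>u \<in> V. d u = n \<and> (u, v) \<in> R"
  shows "\<exists>r. \<forall>n. r n \<in> V \<and> d (r n) = n \<and> (r n, r (Suc n)) \<in> R"
proof -
  define Q where "Q = {(u, v). u \<in> V \<and> v \<in> V \<and> (u, v) \<in> R \<and> d v = Suc (d u)}"
  have reach: "\<exists>b \<in> V. d b = 0 \<and> (b, v) \<in> Q\<^sup>*" if "v \<in> V" "d v = n" for v n
    using that
  proof (induction n arbitrary: v)
    case (Suc n)
    then obtain u where u: "u \<in> V" "d u = n" "(u, v) \<in> R" using parent by blast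
    then obtain b where "b \<in> V" "d b = 0" "(b, u) \<in> Q\<^sup>*" using Suc.IH by blast
    moreover have "(u, v) \<in> Q" using u Suc.prems by (simp add: Q_def)
    ultimately show ?case by (meson rtrancl.rtrancl_into_rtrancl)
  qed auto
  have "\<exists>b \<in> {v \<in> V. d v = 0}. infinite (Q\<^sup>* `` {b})"
  proof (rule ccontr)
    assume "\<not> ?thesis"
    then have "finite (\<Union>b \<in> {v \<in> V. d v = 0}. Q\<^sup>* `` {b})" using roots by blast
    moreover have "V \<subseteq> (\<Union>b \<in> {v \<in> V. d v = 0}. Q\<^sup>* `` {b})" using reach by blast
    ultimately show False using V finite_subset by blast
  qed
  then obtain b where b: "b \<in> V" "d b = 0" "infinite (Q\<^sup>* `` {b})" by blast
  have "\<exists>r. \<forall>n. (r n \<in> V \<and> infinite (Q\<^sup>* `` {r n}) \<and> d (r n) = n) \<and> (r n, r (Suc n)) \<in> Q"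
  proof (rule dependent_nat_choice)
    show "\<exists>x. x \<in> V \<and> infinite (Q\<^sup>* `` {x}) \<and> d x = 0" using b by blast
  next
    fix x n assume x: "x \<in> V \<and> infinite (Q\<^sup>* `` {x}) \<and> d x = n"
    have "Q `` {x} \<subseteq> R `` {x}" by (auto simp: Q_def)
    then have fin: "finite (Q `` {x})" using branching x finite_subset by blast
    have "Q\<^sup>* `` {x} \<subseteq> insert x (\<Union>y \<in> Q `` {x}. Q\<^sup>* `` {y})"
      by (auto elim: converse_rtranclE)
    then have "infinite (\<Union>y \<in> Q `` {x}. Q\<^sup>* `` {y})"
      using x finite_subset by (metis finite_insert)
    then obtain y where "y \<in> Q `` {x}" "infinite (Q\<^sup>* `` {y})"
      using fin by blast
    then show "\<exists>y. (y \<in> V \<and> infinite (Q\<^sup>* `` {y}) \<and> d y = Suc n) \<and> (x, y) \<in> Q"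
      using x by (auto simp: Q_def)
  qed
  then show ?thesis by (auto simp: Q_def)
qed

section \<open>Joined vertices, rays and the end relation\<close>

lemma joined_trans: "(u, v) \<in> joined E V \<Longrightarrow> (v, w) \<in> joined E V \<Longrightarrow> (u, w) \<in> joined E V"
  by (auto simp: joined_def)

lemma joined_sym: "sym E \<Longrightarrow> (u, v) \<in> joined E V \<Longrightarrow> (v, u) \<in> joined E V"
proof -
  assume "sym E"
  then have "sym ((E \<inter> V \<times> V)\<^sup>*)"
    by (intro sym_rtrancl) (auto simp: sym_def)
  then show "(u, v) \<in> joined E V \<Longrightarrow> (v, u) \<in> joined E V"
    by (auto simp: joined_def dest: symD)
qed

lemma joined_edge:
  "(u, v) \<in> joined E V \<Longrightarrow> (v, w) \<in> E \<Longrightarrow> w \<in> V \<Longrightarrow> (u, w) \<in> joined E V"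
  by (auto simp: joined_def intro: rtrancl.rtrancl_into_rtrancl)

lemma joined_mono: "U \<subseteq> V \<Longrightarrow> joined E U \<subseteq> joined E V"
proof -
  assume "U \<subseteq> V"
  then have "(E \<inter> U \<times> U)\<^sup>* \<subseteq> (E \<inter> V \<times> V)\<^sup>*" by (intro rtrancl_mono) auto
  then show ?thesis using \<open>U \<subseteq> V\<close> by (auto simp: joined_def)
qed

lemma joined_closed:
  assumes "(u, v) \<in> joined E V" "u \<in> A"
    and "\<And>a b. a \<in> A \<Longrightarrow> (a, b) \<in> E \<Longrightarrow> a \<in> V \<Longrightarrow> b \<in> V \<Longrightarrow> b \<in> A"
  shows "v \<in> A"
proof -
  have "(u, v) \<in> (E \<inter> V \<times> V)\<^sup>*" using assms(1) by (simp add: joined_def)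
  then show ?thesis using assms(2,3) by (induction rule: rtrancl_induct) auto
qed

lemma ray_avoids_finite:
  fixes r :: "nat \<Rightarrow> 'v"
  assumes "inj r" "finite K"
  shows "\<exists>N. \<forall>i \<ge> N. r i \<notin> K"
proof -
  have "finite (r -` K)" using assms by (intro finite_vimageI)
  then obtain N where "\<forall>i \<in> r -` K. i < N"
    by (auto simp: finite_nat_set_iff_bounded)
  then have "r i \<notin> K" if "N \<le> i" for i
    using that by (metis leD vimageI)
  then show ?thesis by blast
qed

lemma ray_joined:
  assumes r: "r \<in> graph_rays E" and E: "sym E" and out: "\<forall>i \<ge> N. r i \<in> V"
    and ij: "N \<le> i" "N \<le> j"
  shows "(r i, r j) \<in> joined E V"
proof -
  have le: "(r i, r j) \<in> joined E V" if "i \<le> j" "N \<le> i" for i j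
    using that
  proof (induction j rule: dec_induct)
    case base
    then show ?case using out by (auto simp: joined_def)
  next
    case (step j)
    have "(r j, r (Suc j)) \<in> E" using r by (simp add: graph_rays_def)
    moreover have "r (Suc j) \<in> V" using out step by simp
    ultimately show ?case using step joined_edge by metis
  qed
  show ?thesis
    using le[of i j] le[of j i] joined_sym[OF E] ij by (cases "i \<le> j") auto
qed

lemma equiv_same_end:
  assumes E: "sym E"
  shows "equiv (graph_rays E) (same_end E)"
proof (rule equivI)
  show "same_end E \<subseteq> graph_rays E \<times> graph_rays E"
    by (auto simp: same_end_def)
  show "refl_on (graph_rays E) (same_end E)"
  proof (rule refl_onI)
    fix r assume r: "r \<in> graph_rays E"
    have "\<exists>N. \<forall>i \<ge> N. \<forall>j \<ge> N. (r i, r j) \<in> joined E (- K)" if K: "finite K" for K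
    proof -
      obtain N where "\<forall>i \<ge> N. r i \<in> - K"
        using ray_avoids_finite[OF _ K, of r] r by (auto simp: graph_rays_def)
      then show ?thesis using ray_joined[OF r E] by blast
    qed
    then show "(r, r) \<in> same_end E" using r by (auto simp: same_end_def)
  qed
  show "sym (same_end E)"
  proof (rule symI)
    fix r r' assume rr: "(r, r') \<in> same_end E"
    have "\<exists>N. \<forall>i \<ge> N. \<forall>j \<ge> N. (r' i, r j) \<in> joined E (- K)" if K: "finite K" for K
    proof -
      obtain N where "\<forall>i \<ge> N. \<forall>j \<ge> N. (r i, r' j) \<in> joined E (- K)"
        using rr K unfolding same_end_def by blast
      then show ?thesis using joined_sym[OF E] by blast
    qed
    then show "(r', r) \<in> same_end E" using rr by (auto simp: same_end_def)
  qed
  show "trans (same_end E)"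
  proof (rule transI)
    fix r r' r'' assume rr: "(r, r') \<in> same_end E" "(r', r'') \<in> same_end E"
    have "\<exists>N. \<forall>i \<ge> N. \<forall>j \<ge> N. (r i, r'' j) \<in> joined E (- K)" if K: "finite K" for K
    proof -
      obtain N where N: "\<forall>i \<ge> N. \<forall>j \<ge> N. (r i, r' j) \<in> joined E (- K)"
        using rr(1) K unfolding same_end_def by blast
      obtain M where M: "\<forall>i \<ge> M. \<forall>j \<ge> M. (r' i, r'' j) \<in> joined E (- K)"
        using rr(2) K unfolding same_end_def by blast
      have "(r i, r'' j) \<in> joined E (- K)" if "max N M \<le> i" "max N M \<le> j" for i j
        using N M that joined_trans[of "r i" "r' (max N M)" E "- K" "r'' j"] by auto
      then show ?thesis by blast
    qed
    then show "(r, r'') \<in> same_end E" using rr by (auto simp: same_end_def)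
  qed
qed

section \<open>Almost invariant sets and the ends of Cayley graphs\<close>

context group
begin

text \<open>One inclusion for all \<open>g\<close> covers both: the elements that enter
  \<open>A\<close> under \<open>g\<close> correspond, by right translation, to those that leave
  \<open>A\<close> under \<open>inv g\<close>.\<close>

definition almost_invariant :: "'a set \<Rightarrow> bool" where
  "almost_invariant A \<longleftrightarrow> A \<subseteq> carrier G \<and> (\<forall>g \<in> carrier G. finite {w \<in> A. w \<otimes> g \<notin> A})"

lemma finite_mult_preimage:
  assumes "finite K" "g \<in> carrier G"
  shows "finite {w \<in> carrier G. w \<otimes> g \<in> K}"
proof (rule finite_imageD)
  show "finite ((\<lambda>w. w \<otimes> g) ` {w \<in> carrier G. w \<otimes> g \<in> K})"
    by (rule finite_subset[OF _ assms(1)]) auto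
  show "inj_on (\<lambda>w. w \<otimes> g) {w \<in> carrier G. w \<otimes> g \<in> K}"
    using assms(2) by (auto simp: inj_on_def)
qed

text \<open>An element leaves \<open>A\<close> under \<open>g h\<close> only if it leaves under
  \<open>g\<close> or its translate by \<open>g\<close> leaves under \<open>h\<close>. So a check on
  one generating set serves every other one.\<close>

lemma almost_invariant_generate:
  assumes X: "generate G X = carrier G" "X \<subseteq> carrier G" and A: "A \<subseteq> carrier G"
    and x: "\<And>x. x \<in> X \<Longrightarrow> finite {w \<in> A. w \<otimes> x \<notin> A}"
    and x': "\<And>x. x \<in> X \<Longrightarrow> finite {w \<in> A. w \<otimes> inv x \<notin> A}"
  shows "almost_invariant A"
proof -
  have "finite {w \<in> A. w \<otimes> g \<notin> A}" if "g \<in> generate G X" for g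
    using that
  proof (induction)
    case one
    have "{w \<in> A. w \<otimes> \<one> \<notin> A} = {}" using A by auto
    then show ?case by (simp only: finite.emptyI)
  next
    case (eng g h)
    have gh: "g \<in> carrier G" "h \<in> carrier G" using eng X by auto
    have "finite {w \<in> carrier G. w \<otimes> g \<in> {w \<in> A. w \<otimes> h \<notin> A}}"
      using finite_mult_preimage[OF eng.IH(2) gh(1)] .
    moreover have "{w \<in> A. w \<otimes> (g \<otimes> h) \<notin> A}
        \<subseteq> {w \<in> A. w \<otimes> g \<notin> A} \<union> {w \<in> carrier G. w \<otimes> g \<in> {w \<in> A. w \<otimes> h \<notin> A}}"
      using A gh by (auto simp: m_assoc)
    ultimately show ?case using eng.IH(1) finite_subset by blast
  qed (use x x' in auto)
  then show ?thesis using A X by (simp add: almost_invariant_def)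
qed

lemma sym_cayley_edges: "sym (cayley_edges G X)"
  by (auto simp: sym_def cayley_edges_def)

lemma cayley_edges_carrier: "cayley_edges G X \<subseteq> carrier G \<times> carrier G"
  by (auto simp: cayley_edges_def)

lemma cayley_edges_iff:
  assumes "X \<subseteq> carrier G"
  shows "(g, h) \<in> cayley_edges G X \<longleftrightarrow> g \<in> carrier G \<and> (\<exists>x \<in> X. h = g \<otimes> x \<or> h = g \<otimes> inv x)"
proof -
  have "h \<in> carrier G \<and> g = h \<otimes> x \<longleftrightarrow> h = g \<otimes> inv x" if "g \<in> carrier G" "x \<in> X" for x
    using that assms by (auto simp: m_assoc)
  then show ?thesis
    using assms by (auto simp: cayley_edges_def)
qed

lemma cayley_connected:
  assumes X: "X \<subseteq> carrier G" and g: "g \<in> generate G X"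
  shows "a \<in> carrier G \<Longrightarrow> (a, a \<otimes> g) \<in> (cayley_edges G X)\<^sup>*"
  using g
proof (induction arbitrary: a)
  case one
  then show ?case by simp
next
  case (incl x)
  then show ?case using cayley_edges_iff[OF X] by blast
next
  case (inv x)
  then show ?case using cayley_edges_iff[OF X] by blast
next
  case (eng g h)
  have gh: "g \<in> carrier G" "h \<in> carrier G" using eng X generate_in_carrier by auto
  then have "(a, a \<otimes> g) \<in> (cayley_edges G X)\<^sup>*" "(a \<otimes> g, a \<otimes> g \<otimes> h) \<in> (cayley_edges G X)\<^sup>*"
    using eng by auto
  then show ?case using gh eng.prems by (simp add: m_assoc)
qed

text \<open>Two rays in different ends are separated by a finite \<open>K\<close>; \<open>A\<close>
  is the component of a tail of the first ray outside \<open>K\<close>. Multiplication by a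
  generator follows an edge, so it can leave \<open>A\<close> only by landing in
  \<open>K\<close>.\<close>

lemma two_ends_almost_invariant:
  assumes X: "X \<subseteq> carrier G" "generate G X = carrier G"
    and two: "card (graph_ends (cayley_edges G X)) = 2"
  shows "\<exists>A. almost_invariant A \<and> infinite A \<and> infinite (carrier G - A)"
proof -
  let ?E = "cayley_edges G X"
  have "\<exists>c d. c \<in> graph_ends ?E \<and> d \<in> graph_ends ?E \<and> c \<noteq> d"
    using two by (auto simp: card_2_iff)
  then obtain r r' where r: "r \<in> graph_rays ?E" "r' \<in> graph_rays ?E" "same_end ?E `` {r} \<noteq> same_end ?E `` {r'}"
    unfolding graph_ends_def by (metis quotientE)
  then have "(r, r') \<notin> same_end ?E"
    using equiv_class_eq[OF equiv_same_end[OF sym_cayley_edges]] by blast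
  then obtain K where K: "finite K"
    and sep: "\<And>N. \<exists>i \<ge> N. \<exists>j \<ge> N. (r i, r' j) \<notin> joined ?E (- K)"
    using r by (auto simp: same_end_def)
  have inj: "inj r" "inj r'" using r by (auto simp: graph_rays_def)
  obtain N N' where "\<forall>i \<ge> N. r i \<in> - K" "\<forall>i \<ge> N'. r' i \<in> - K"
    using ray_avoids_finite[OF inj(1) K] ray_avoids_finite[OF inj(2) K] by auto
  then have M: "\<forall>i \<ge> max N N'. r i \<in> - K" "\<forall>i \<ge> max N N'. r' i \<in> - K" by auto
  define M where "M = max N N'"
  define A where "A = {v. (r M, v) \<in> joined ?E (- K)}"
  note rj = ray_joined[OF r(1) sym_cayley_edges M(1)[folded M_def]]
  note rj' = ray_joined[OF r(2) sym_cayley_edges M(2)[folded M_def]]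
  have rA: "r i \<in> A" if "M \<le> i" for i
    using rj[OF order_refl that] by (simp add: A_def)
  have rA': "r' j \<notin> A" if j: "M \<le> j" for j
  proof
    assume "r' j \<in> A"
    then have *: "(r M, r' j) \<in> joined ?E (- K)" by (simp add: A_def)
    obtain i j' where "M \<le> i" "M \<le> j'" "(r i, r' j') \<notin> joined ?E (- K)" using sep by blast
    then show False
      using joined_trans[OF rj[of i M] joined_trans[OF * rj'[OF j, of j']]] by auto
  qed
  have carr: "r i \<in> carrier G" "r' i \<in> carrier G" for i
    using r cayley_edges_carrier by (fastforce simp: graph_rays_def)+
  have A: "A \<subseteq> carrier G"
  proof
    fix v assume "v \<in> A"
    then show "v \<in> carrier G"
      using joined_closed[of "r M" v ?E "- K" "carrier G"] carr cayley_edges_carrier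
      unfolding A_def by blast
  qed
  have step: "finite {w \<in> A. w \<otimes> g \<notin> A}"
    if g: "g \<in> carrier G" and edge: "\<And>w. w \<in> carrier G \<Longrightarrow> (w, w \<otimes> g) \<in> ?E" for g
  proof (rule finite_subset)
    show "finite {w \<in> carrier G. w \<otimes> g \<in> K}" using finite_mult_preimage[OF K g] .
    show "{w \<in> A. w \<otimes> g \<notin> A} \<subseteq> {w \<in> carrier G. w \<otimes> g \<in> K}"
      using A edge joined_edge[of "r M" _ ?E "- K"] by (auto simp: A_def)
  qed
  have "almost_invariant A"
  proof (rule almost_invariant_generate[OF X(2,1) A])
    fix x assume x: "x \<in> X"
    then have xc: "x \<in> carrier G" using X by blast
    show "finite {w \<in> A. w \<otimes> x \<notin> A}"
      using step[OF xc] x cayley_edges_iff[OF X(1)] by blast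
    show "finite {w \<in> A. w \<otimes> inv x \<notin> A}"
      using step[OF inv_closed[OF xc]] x cayley_edges_iff[OF X(1)] by blast
  qed
  moreover have "infinite (r ` {M..})" "infinite (r' ` {M..})"
    using inj finite_imageD infinite_Ici inj_on_subset by (metis subset_UNIV)+
  moreover have "r ` {M..} \<subseteq> A" "r' ` {M..} \<subseteq> carrier G - A"
    using rA rA' carr by auto
  ultimately show ?thesis using finite_subset by blast
qed

definition frontier_in :: "'a set \<Rightarrow> 'a set \<Rightarrow> 'a set" where
  "frontier_in X A = {w \<in> A. \<exists>x \<in> X. w \<otimes> x \<notin> A \<or> w \<otimes> inv x \<notin> A}"

lemma finite_frontier_in:
  assumes "finite X" "X \<subseteq> carrier G" "almost_invariant A"
  shows "finite (frontier_in X A)"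
proof (rule finite_subset)
  show "frontier_in X A \<subseteq> (\<Union>x \<in> X. {w \<in> A. w \<otimes> x \<notin> A} \<union> {w \<in> A. w \<otimes> inv x \<notin> A})"
    by (auto simp: frontier_in_def)
  show "finite (\<Union>x \<in> X. {w \<in> A. w \<otimes> x \<notin> A} \<union> {w \<in> A. w \<otimes> inv x \<notin> A})"
    using assms inv_closed unfolding almost_invariant_def by blast
qed

text \<open>On a path from \<open>a\<close> to a vertex of \<open>A\<close>, the last entry into
  \<open>A\<close> is a frontier vertex. So all of \<open>A\<close> is reached inside
  \<open>A\<close> from a finite set, and \<open>koenig\<close> applies to the distance
  \<open>d\<close> from that set.\<close>

lemma almost_invariant_ray:
  assumes X: "finite X" "X \<subseteq> carrier G" "generate G X = carrier G"
    and A: "almost_invariant A" "infinite A"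
  shows "\<exists>r \<in> graph_rays (cayley_edges G X). \<forall>n. r n \<in> A"
proof -
  let ?E = "cayley_edges G X"
  have Ac: "A \<subseteq> carrier G" using A by (simp add: almost_invariant_def)
  obtain a where a: "a \<in> A" using A by (metis ex_in_conv finite.emptyI)
  \<comment> \<open>The point \<open>a\<close> itself serves the paths that never leave
    \<open>A\<close>.\<close>
  define B where "B = insert a (frontier_in X A)"
  have B: "finite B" "B \<subseteq> A"
    using a finite_frontier_in[OF X(1,2) A(1)] by (auto simp: B_def frontier_in_def)
  define R where "R = ?E \<inter> A \<times> A"
  have reach: "v \<in> A \<Longrightarrow> \<exists>b \<in> B. (b, v) \<in> R\<^sup>*" if "(a, v) \<in> ?E\<^sup>*" for v
    using that
  proof (induction rule: rtrancl_induct)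
    case base
    then show ?case by (auto simp: B_def)
  next
    case (step v w)
    show ?case
    proof (cases "v \<in> A")
      case True
      then have "(v, w) \<in> R" using step by (simp add: R_def)
      then show ?thesis using step True by (meson rtrancl.rtrancl_into_rtrancl)
    next
      case False
      have "(w, v) \<in> ?E" using step.hyps sym_cayley_edges by (meson symE)
      then have "w \<in> frontier_in X A"
        using False step.prems unfolding cayley_edges_iff[OF X(2)] frontier_in_def by blast
      then show ?thesis by (auto simp: B_def)
    qed
  qed
  have ex: "\<exists>n. \<exists>b \<in> B. (b, v) \<in> R ^^ n" if "v \<in> A" for v
  proof -
    have "inv a \<otimes> v \<in> generate G X" using a that Ac X(3) by auto
    then have "(a, a \<otimes> (inv a \<otimes> v)) \<in> ?E\<^sup>*" using cayley_connected[OF X(2)] a Ac by blast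
    moreover have "a \<otimes> (inv a \<otimes> v) = v"
      using subsetD[OF Ac a] subsetD[OF Ac that] by (simp flip: m_assoc)
    ultimately have "\<exists>b \<in> B. (b, v) \<in> R\<^sup>*" using reach that by metis
    then show ?thesis by (auto simp: rtrancl_power)
  qed
  define d where "d = (\<lambda>v. LEAST n. \<exists>b \<in> B. (b, v) \<in> R ^^ n)"
  have d: "\<exists>b \<in> B. (b, v) \<in> R ^^ d v" if "v \<in> A" for v
    using LeastI_ex[OF ex[OF that]] by (simp add: d_def)
  have d_le: "d v \<le> n" if "b \<in> B" "(b, v) \<in> R ^^ n" for b v n
    unfolding d_def using that by (intro Least_le) blast
  have "\<exists>r. \<forall>n. r n \<in> A \<and> d (r n) = n \<and> (r n, r (Suc n)) \<in> R"
  proof (rule koenig[OF A(2)])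
    have "{v \<in> A. d v = 0} \<subseteq> B" using d by fastforce
    then show "finite {v \<in> A. d v = 0}" using B finite_subset by blast
  next
    fix v assume "v \<in> A"
    have "R `` {v} \<subseteq> (\<lambda>x. v \<otimes> x) ` X \<union> (\<lambda>x. v \<otimes> inv x) ` X"
      using cayley_edges_iff[OF X(2)] by (auto simp: R_def)
    then show "finite (R `` {v})" using X(1) by (meson finite_UnI finite_imageI finite_subset)
  next
    fix v n assume v: "v \<in> A" "d v = Suc n"
    then obtain b where b: "b \<in> B" "(b, v) \<in> R ^^ Suc n" using d by metis
    then obtain u where u: "(b, u) \<in> R ^^ n" "(u, v) \<in> R" by auto
    then have uA: "u \<in> A" by (auto simp: R_def)
    obtain b' where "b' \<in> B" "(b', u) \<in> R ^^ d u" using d[OF uA] by blast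
    then have "d v \<le> Suc (d u)" using d_le[of b' v "Suc (d u)"] u by auto
    moreover have "d u \<le> n" using d_le b u by blast
    ultimately show "\<exists>u \<in> A. d u = n \<and> (u, v) \<in> R" using u uA v by auto
  qed
  then obtain r where r: "\<And>n. r n \<in> A" "\<And>n. d (r n) = n" "\<And>n. (r n, r (Suc n)) \<in> R" by blast
  have "inj r" using r(2) by (metis injI)
  then have "r \<in> graph_rays ?E" using r(3) by (auto simp: graph_rays_def R_def)
  then show ?thesis using r(1) by blast
qed

text \<open>Outside the frontier no edge leaves \<open>A\<close>, so removing this finite set
  separates the two rays.\<close>

lemma disjoint_almost_invariant_not_same_end:
  assumes X: "finite X" "X \<subseteq> carrier G"
    and A: "almost_invariant A" and r: "\<forall>n. r n \<in> A" "\<forall>n. r' n \<notin> A"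
  shows "(r, r') \<notin> same_end (cayley_edges G X)"
proof
  let ?E = "cayley_edges G X" and ?K = "frontier_in X A"
  assume "(r, r') \<in> same_end ?E"
  then obtain N where "\<forall>i \<ge> N. \<forall>j \<ge> N. (r i, r' j) \<in> joined ?E (- ?K)"
    using finite_frontier_in[OF X A] unfolding same_end_def by blast
  then have "(r N, r' N) \<in> joined ?E (- ?K)" by blast
  then have "r' N \<in> A"
    by (rule joined_closed) (use r in \<open>auto simp: cayley_edges_iff[OF X(2)] frontier_in_def\<close>)
  then show False using r by blast
qed

lemma three_almost_invariant_not_two_ends:
  assumes X: "finite X" "X \<subseteq> carrier G" "generate G X = carrier G"
    and A: "almost_invariant A" "infinite A" and B: "almost_invariant B" "infinite B"
    and C: "almost_invariant C" "infinite C"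
    and disj: "A \<inter> B = {}" "A \<inter> C = {}" "B \<inter> C = {}"
  shows "card (graph_ends (cayley_edges G X)) \<noteq> 2"
proof
  let ?E = "cayley_edges G X"
  assume two: "card (graph_ends ?E) = 2"
  obtain a b c where abc: "a \<in> graph_rays ?E" "b \<in> graph_rays ?E" "c \<in> graph_rays ?E"
    and inA: "\<forall>n. a n \<in> A" and inB: "\<forall>n. b n \<in> B" and inC: "\<forall>n. c n \<in> C"
    using almost_invariant_ray[OF X A] almost_invariant_ray[OF X B] almost_invariant_ray[OF X C] by blast
  have "(a, b) \<notin> same_end ?E" "(a, c) \<notin> same_end ?E" "(b, c) \<notin> same_end ?E"
    using disjoint_almost_invariant_not_same_end[OF X(1,2) A(1) inA, of b]
      disjoint_almost_invariant_not_same_end[OF X(1,2) A(1) inA, of c]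
      disjoint_almost_invariant_not_same_end[OF X(1,2) B(1) inB, of c] inB inC disj by blast+
  then have ne: "same_end ?E `` {a} \<noteq> same_end ?E `` {b}" "same_end ?E `` {a} \<noteq> same_end ?E `` {c}"
      "same_end ?E `` {b} \<noteq> same_end ?E `` {c}"
    using abc eq_equiv_class[OF _ equiv_same_end[OF sym_cayley_edges]] by metis+
  have "{same_end ?E `` {a}, same_end ?E `` {b}, same_end ?E `` {c}} \<subseteq> graph_ends ?E"
    using abc by (auto simp: graph_ends_def intro: quotientI)
  moreover have "finite (graph_ends ?E)" using two card.infinite by fastforce
  ultimately have "card {same_end ?E `` {a}, same_end ?E `` {b}, same_end ?E `` {c}} \<le> 2"
    using card_mono two by metis
  then show False using ne by simp
qed

end

text \<open>A criterion for a thickened line with height \<open>h\<close> and spine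
  \<open>c\<close>. A ray finally avoids the finite fibre over 0, after which its height cannot
  change sign, and the finite slabs drive it to one side. Two rays on one side are joined far out
  through the connected fibres and the spine; the fibre over 0 separates the two sides.\<close>

lemma line_two_ends:
  fixes E :: "('v \<times> 'v) set" and h :: "'v \<Rightarrow> int" and c :: "int \<Rightarrow> 'v"
  assumes E: "sym E" "E \<subseteq> V \<times> V"
    and fibres: "\<And>n. finite {v \<in> V. h v = n}"
    and lipschitz: "\<And>u v. (u, v) \<in> E \<Longrightarrow> \<bar>h u - h v\<bar> \<le> 1"
    and c: "\<And>n. h (c n) = n" "\<And>n. (c n, c (n + 1)) \<in> E"
    and fibre_connected: "\<And>v. v \<in> V \<Longrightarrow> (v, c (h v)) \<in> joined E {w. h w = h v}"
  shows "card (graph_ends E) = 2"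
proof -
  \<comment> \<open>The sign \<open>\<sigma>\<close>, equal to 1 or -1, lets one argument treat both
    ends.\<close>
  define tends where "tends = (\<lambda>\<sigma> r. \<forall>N. \<exists>M. \<forall>i \<ge> M. N < \<sigma> * h (r (i :: nat)))"
  have ray_V: "r i \<in> V" if "r \<in> graph_rays E" for r i
    using that E(2) by (fastforce simp: graph_rays_def)
  have ray_inj: "inj r" if "r \<in> graph_rays E" for r
    using that by (simp add: graph_rays_def)
  have slab: "finite {v \<in> V. \<bar>h v\<bar> \<le> N}" for N
  proof (rule finite_subset)
    show "finite (\<Union>n \<in> {-N..N}. {v \<in> V. h v = n})" using fibres by blast
  qed auto
  have constant_sign: "tends \<sigma> r"
    if r: "r \<in> graph_rays E" and \<sigma>: "\<bar>\<sigma>\<bar> = 1" and M0: "\<And>i. M0 \<le> i \<Longrightarrow> h (r i) \<noteq> 0"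
      and start: "0 < \<sigma> * h (r M0)" for r \<sigma> M0
  proof -
    have pos: "0 < \<sigma> * h (r i)" if "M0 \<le> i" for i
      using that
    proof (induction i rule: dec_induct)
      case base
      then show ?case using start .
    next
      case (step i)
      have "(r i, r (Suc i)) \<in> E" using r by (simp add: graph_rays_def)
      then have "\<bar>h (r i) - h (r (Suc i))\<bar> \<le> 1" using lipschitz by blast
      moreover have "h (r (Suc i)) \<noteq> 0" using M0 step by simp
      moreover have "\<sigma> = 1 \<or> \<sigma> = -1" using \<sigma> by linarith
      ultimately show ?case using step.IH by auto
    qed
    have "\<exists>M. \<forall>i \<ge> M. N < \<sigma> * h (r i)" for N
    proof -
      obtain M where M: "\<forall>i \<ge> M. r i \<notin> {v \<in> V. \<bar>h v\<bar> \<le> N}"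
        using ray_avoids_finite[OF ray_inj[OF r] slab[of N]] by blast
      have "N < \<sigma> * h (r i)" if "max M M0 \<le> i" for i
      proof -
        have "N < \<bar>h (r i)\<bar>" using M that ray_V[OF r, of i] by (auto simp: not_le)
        moreover have "\<bar>h (r i)\<bar> = \<bar>\<sigma> * h (r i)\<bar>" using \<sigma> by (simp add: abs_mult)
        moreover have "0 < \<sigma> * h (r i)" using pos that by simp
        ultimately show ?thesis by simp
      qed
      then show ?thesis by blast
    qed
    then show ?thesis by (simp add: tends_def)
  qed
  have dichotomy: "tends 1 r \<or> tends (-1) r" if r: "r \<in> graph_rays E" for r
  proof -
    obtain M0 where "\<forall>i \<ge> M0. r i \<notin> {v \<in> V. h v = 0}"
      using ray_avoids_finite[OF ray_inj[OF r] fibres[of 0]] by blast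
    then have M0: "\<And>i. M0 \<le> i \<Longrightarrow> h (r i) \<noteq> 0" using ray_V[OF r] by blast
    then have "0 < 1 * h (r M0) \<or> 0 < (-1) * h (r M0)" using M0[of M0] by linarith
    then show ?thesis
      using constant_sign[OF r _ M0, of 1 M0] constant_sign[OF r _ M0, of "-1" M0] by auto
  qed
  have line: "(c a, c b) \<in> joined E {w. N < \<sigma> * h w}"
    if \<sigma>: "\<bar>\<sigma>\<bar> = 1" and ab: "N < \<sigma> * a" "N < \<sigma> * b" for \<sigma> N a b
  proof -
    have le: "(c a, c b) \<in> joined E {w. N < \<sigma> * h w}"
      if "a \<le> b" "N < \<sigma> * a" "N < \<sigma> * b" for a b
      using that
    proof (induction b rule: int_ge_induct)
      case base
      then show ?case by (auto simp: joined_def c)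
    next
      case (step b)
      have "\<sigma> = 1 \<or> \<sigma> = -1" using \<sigma> by linarith
      then have "N < \<sigma> * b" using step.prems step.hyps by auto
      then have "(c a, c b) \<in> joined E {w. N < \<sigma> * h w}" using step by blast
      then show ?case using joined_edge c step.prems by fastforce
    qed
    show ?thesis
      using le[of a b] le[of b a] joined_sym[OF E(1)] ab by (cases "a \<le> b") auto
  qed
  have half_connected: "(u, v) \<in> joined E {w. N < \<sigma> * h w}"
    if \<sigma>: "\<bar>\<sigma>\<bar> = 1" and "u \<in> V" "v \<in> V" and uv: "N < \<sigma> * h u" "N < \<sigma> * h v" for \<sigma> N u v
  proof -
    have fibre: "(v, c (h v)) \<in> joined E {w. N < \<sigma> * h w}" if v: "v \<in> V" "N < \<sigma> * h v" for v
    proof -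
      have "{w. h w = h v} \<subseteq> {w. N < \<sigma> * h w}" using v by auto
      then show ?thesis using fibre_connected[OF v(1)] joined_mono by blast
    qed
    have "(u, c (h u)) \<in> joined E {w. N < \<sigma> * h w}" "(v, c (h v)) \<in> joined E {w. N < \<sigma> * h w}"
      using fibre that by blast+
    then show ?thesis
      using line[OF \<sigma> uv] joined_trans joined_sym[OF E(1)] by metis
  qed
  have same: "(r, r') \<in> same_end E"
    if r: "r \<in> graph_rays E" "r' \<in> graph_rays E" and \<sigma>: "\<bar>\<sigma>\<bar> = 1"
      and tends: "tends \<sigma> r" "tends \<sigma> r'" for r r' \<sigma>
  proof -
    have "\<exists>N. \<forall>i \<ge> N. \<forall>j \<ge> N. (r i, r' j) \<in> joined E (- K)" if K: "finite K" for K
    proof -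
      define B where "B = Max (insert 0 ((\<lambda>v. \<sigma> * h v) ` K))"
      have "\<sigma> * h v \<le> B" if "v \<in> K" for v
        unfolding B_def using K that by (intro Max_ge) auto
      then have sub: "{w. B < \<sigma> * h w} \<subseteq> - K" by (auto simp: not_le[symmetric])
      obtain M M' where M: "\<forall>i \<ge> M. B < \<sigma> * h (r i)" "\<forall>i \<ge> M'. B < \<sigma> * h (r' i)"
        using tends unfolding tends_def by metis
      have "(r i, r' j) \<in> joined E (- K)" if "max M M' \<le> i" "max M M' \<le> j" for i j
        using half_connected[OF \<sigma> ray_V[OF r(1)] ray_V[OF r(2)], of B i j] M that
          joined_mono[OF sub] by auto
      then show ?thesis by blast
    qed
    then show ?thesis using r by (simp add: same_end_def)
  qed
  define p where "p = (\<lambda>n. c (int n))"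
  define q where "q = (\<lambda>n. c (- int n))"
  have "inj p" "inj q"
    unfolding p_def q_def by (rule injI, metis c(1) of_nat_eq_iff neg_equal_iff_equal)+
  moreover have "(p n, p (Suc n)) \<in> E" for n
    using c(2)[of "int n"] by (simp add: p_def add.commute)
  moreover have "(q n, q (Suc n)) \<in> E" for n
    using symD[OF E(1) c(2)[of "- int (Suc n)"]] by (simp add: q_def)
  ultimately have pq: "p \<in> graph_rays E" "q \<in> graph_rays E" by (simp_all add: graph_rays_def)
  have "\<exists>M. \<forall>i \<ge> M. N < int i" for N
    by (rule exI[of _ "nat (N + 1)"]) auto
  then have tends_p: "tends 1 p" and tends_q: "tends (-1) q"
    by (simp_all add: tends_def p_def q_def c)
  have "(p, q) \<notin> same_end E"
  proof
    assume "(p, q) \<in> same_end E"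
    then obtain N where "\<forall>i \<ge> N. \<forall>j \<ge> N. (p i, q j) \<in> joined E (- {v \<in> V. h v = 0})"
      using fibres unfolding same_end_def by blast
    then have "(p (Suc N), q (Suc N)) \<in> joined E (- {v \<in> V. h v = 0})" by simp
    then have "q (Suc N) \<in> {v. 0 < h v}"
    proof (rule joined_closed)
      fix a b assume "a \<in> {v. 0 < h v}" "(a, b) \<in> E" "b \<in> - {v \<in> V. h v = 0}"
      then show "b \<in> {v. 0 < h v}"
        using lipschitz[of a b] E(2) by force
    qed (simp add: p_def c)
    then show False by (simp add: q_def c)
  qed
  then have "same_end E `` {p} \<noteq> same_end E `` {q}"
    using eq_equiv_class[OF _ equiv_same_end[OF E(1)] pq(2)] by blast
  moreover have "graph_ends E = {same_end E `` {p}, same_end E `` {q}}"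
  proof
    show "{same_end E `` {p}, same_end E `` {q}} \<subseteq> graph_ends E"
      using pq by (auto simp: graph_ends_def intro: quotientI)
    show "graph_ends E \<subseteq> {same_end E `` {p}, same_end E `` {q}}"
    proof
      fix e assume "e \<in> graph_ends E"
      then obtain r where r: "r \<in> graph_rays E" "e = same_end E `` {r}"
        unfolding graph_ends_def by (rule quotientE)
      then have "(r, p) \<in> same_end E \<or> (r, q) \<in> same_end E"
        using dichotomy[OF r(1)] same[of r p 1] same[of r q "-1"] pq tends_p tends_q by auto
      then show "e \<in> {same_end E `` {p}, same_end E `` {q}}"
        using equiv_class_eq[OF equiv_same_end[OF E(1)]] r(2) by blast
    qed
  qed
  ultimately show ?thesis by simp
qed

section \<open>Coxeter groups that are not one-ended\<close>

context coxeter_system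
begin

lemma even_len_pow:
  assumes "s \<in> S" "t \<in> S"
  shows "even (len ((s \<otimes> t) [^] (k :: nat)))"
  using len_val_parity[OF concat_replicate_lists[OF assms, of k]] val_concat_replicate[OF assms, of k]
  by (simp add: length_concat sum_list_replicate)

text \<open>The additivity of \<open>left_min_iff\<close>, carried over to right multiplication by
  inversion.\<close>

lemma right_coset_length:
  assumes T: "T \<subseteq> S" and w: "w \<in> carrier W" and asc: "\<And>t. t \<in> T \<Longrightarrow> len (w \<otimes> t) = Suc (len w)"
    and g: "g \<in> generate W T"
  shows "len (w \<otimes> g) = len w + len g"
proof -
  have gc: "g \<in> carrier W" using generate_closed[OF T g] .
  have "left_min T (inv w)"
  proof (unfold left_min_def, intro conjI ballI)
    fix t assume t: "t \<in> T"
    then have "t \<in> S" using T by blast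
    then show "len (t \<otimes> inv w) = Suc (len (inv w))"
      using asc[OF t] w len_inv[of "w \<otimes> t"] by (simp add: inv_mult_group)
  qed (use w in simp)
  moreover have "inv g \<in> generate W T"
    using g generate_subgroup[OF T] by (simp add: subgroup.m_inv_closed)
  ultimately have "len (inv g \<otimes> inv w) = len g + len w"
    using left_min_iff[OF T, of "inv w"] w gc by auto
  then show ?thesis
    using w gc len_inv[of "w \<otimes> g"] by (simp add: inv_mult_group)
qed

text \<open>The walk around the coset of a finite dihedral subgroup avoids its shortest element.\<close>

lemma dihedral_detour:
  assumes st: "s \<in> S" "t \<in> S" and fin: "m s t \<noteq> \<infinity>" and w: "w \<in> carrier W"
    and asc: "len (w \<otimes> s) = Suc (len w)" "len (w \<otimes> t) = Suc (len w)"
  shows "(w \<otimes> s, w \<otimes> t) \<in> joined (cayley_edges W S) {v \<in> carrier W. len w < len v}"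
    (is "_ \<in> joined ?E ?V")
proof -
  let ?p = "s \<otimes> t"
  have T: "{s, t} \<subseteq> S" using st by simp
  have p: "?p \<in> carrier W" using st by simp
  have gen: "?p \<in> generate W {s, t}"
    by (intro generate.eng generate.incl) auto
  have powgen: "?p [^] k \<in> generate W {s, t}" for k :: nat
    using gen generate_subgroup[OF T] by (induction k) (auto intro: generate.one generate.eng)
  have inV: "w \<otimes> g \<in> ?V" if g: "g \<in> generate W {s, t}" "g \<noteq> \<one>" for g
  proof -
    have gc: "g \<in> carrier W" using generate_closed[OF T g(1)] .
    have "len (w \<otimes> g) = len w + len g"
      using right_coset_length[OF T w _ g(1)] asc by auto
    moreover have "len g \<noteq> 0" using len_zero_iff[OF gc] g(2) by simp
    ultimately show ?thesis using w gc by simp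
  qed
  obtain k where k: "m s t = enat k" using fin by auto
  have "0 < k" using m_pos[OF st] k by (cases k) (auto simp: one_enat_def)
  then have "\<exists>n > 0 :: nat. ?p [^] n = \<one>" using relation[OF st k] by blast
  \<comment> \<open>The exact order \<open>n\<close> of \<open>s t\<close> is used in place of
    \<open>k\<close>, for which only \<open>(s t)^k = 1\<close> is at hand. Minimality keeps the
    intermediate rotations different from \<open>1\<close>, hence the walk away from
    \<open>w\<close>.\<close>
  then obtain n :: nat where n: "0 < n" "?p [^] n = \<one>" and least: "\<And>i. 0 < i \<Longrightarrow> i < n \<Longrightarrow> ?p [^] i \<noteq> \<one>"
    using exists_least_iff[of "\<lambda>n :: nat. 0 < n \<and> ?p [^] n = \<one>"] by blast
  have ps: "?p [^] i \<otimes> s \<in> generate W {s, t}" "?p [^] i \<otimes> s \<noteq> \<one>" for i :: nat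
  proof -
    show "?p [^] i \<otimes> s \<in> generate W {s, t}"
      using powgen generate.incl[of s "{s, t}" W] by (intro generate.eng) auto
    show "?p [^] i \<otimes> s \<noteq> \<one>"
      using len_parity[of "?p [^] i" s] even_len_pow[OF st, of i] st p by auto
  qed
  have walk: "(w \<otimes> s, w \<otimes> (?p [^] i \<otimes> s)) \<in> joined ?E ?V" if "i < n" for i
    using that
  proof (induction i)
    case 0
    then show ?case using inV[OF ps, of 0] st by (simp add: joined_def)
  next
    case (Suc i)
    have pc: "?p [^] i \<in> carrier W" "?p [^] Suc i \<in> carrier W" using p by auto
    have e1: "w \<otimes> ?p [^] Suc i = w \<otimes> (?p [^] i \<otimes> s) \<otimes> t"
      using st w pc by (simp add: m_assoc)
    have "(w \<otimes> (?p [^] i \<otimes> s), w \<otimes> ?p [^] Suc i) \<in> ?E"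
      unfolding e1 using st w pc by (auto simp: cayley_edges_iff[OF S_carrier])
    moreover have "w \<otimes> ?p [^] Suc i \<in> ?V"
      using inV[OF powgen[of "Suc i"]] least[of "Suc i"] Suc.prems by blast
    ultimately have "(w \<otimes> s, w \<otimes> ?p [^] Suc i) \<in> joined ?E ?V"
      using joined_edge Suc by (metis Suc_lessD)
    moreover have "(w \<otimes> ?p [^] Suc i, w \<otimes> (?p [^] Suc i \<otimes> s)) \<in> ?E"
      using st w pc by (auto simp: cayley_edges_iff[OF S_carrier] m_assoc[symmetric] simp del: nat_pow_Suc)
    ultimately show ?case
      using inV[OF ps] by (rule joined_edge)
  qed
  have "?p [^] (n - 1) \<otimes> s \<otimes> t = \<one>"
    using n st p by (cases n) (auto simp: m_assoc)
  then have "?p [^] (n - 1) \<otimes> s \<otimes> t \<otimes> t = t" using st by simp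
  then have "?p [^] (n - 1) \<otimes> s = t"
    using S_cancel_right[of t "?p [^] (n - 1) \<otimes> s"] st p by simp
  then show ?thesis using walk[of "n - 1"] n by simp
qed

section \<open>Connectivity outside balls\<close>

definition finite_adjacent :: "'a set \<Rightarrow> ('a \<times> 'a) set" where
  "finite_adjacent V = {(a, b). a \<in> V \<and> b \<in> V \<and> m a b \<noteq> \<infinity>}"

definition right_descents :: "'a \<Rightarrow> 'a set" where
  "right_descents w = {s \<in> S. len (w \<otimes> s) < len w}"

lemma finite_right_descents:
  assumes "finite S" "w \<in> carrier W"
  shows "finite (generate W (right_descents w))"
proof (rule finite_left_descents[OF assms(1)])
  show "len (t \<otimes> inv w) < len (inv w)" if "t \<in> right_descents w" for t
    using that assms(2) len_inv[of "w \<otimes> t"] by (simp add: right_descents_def inv_mult_group)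
qed (use assms in \<open>auto simp: right_descents_def\<close>)

lemma complement_of_ball_connected:
  assumes S: "finite S"
    and conn: "\<And>D a b. D \<subseteq> S \<Longrightarrow> finite (generate W D) \<Longrightarrow> a \<in> S - D \<Longrightarrow> b \<in> S - D
      \<Longrightarrow> (a, b) \<in> (finite_adjacent (S - D))\<^sup>*"
    and uv: "u \<in> carrier W" "v \<in> carrier W" "n \<le> len u" "n \<le> len v"
  shows "(u, v) \<in> joined (cayley_edges W S) {w \<in> carrier W. n \<le> len w}"
  using uv
proof (induction n arbitrary: u v)
  case 0
  have "inv u \<otimes> v \<in> generate W S" using 0 generate_S by simp
  then have "(u, u \<otimes> (inv u \<otimes> v)) \<in> (cayley_edges W S)\<^sup>*"
    using cayley_connected[OF S_carrier] 0 by blast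
  moreover have "cayley_edges W S \<inter> carrier W \<times> carrier W = cayley_edges W S"
    using cayley_edges_carrier by blast
  ultimately show ?case using 0 by (simp add: joined_def)
next
  case (Suc n)
  let ?E = "cayley_edges W S"
  let ?V = "\<lambda>n. {w \<in> carrier W. n \<le> len w}"
  have detour: "(w \<otimes> s, w \<otimes> t) \<in> joined ?E (?V (Suc n))"
    if w: "w \<in> carrier W" "len w = n" and s: "s \<in> S - right_descents w" and t: "t \<in> S - right_descents w"
    for w s t
  proof -
    let ?D = "right_descents w"
    have asc: "len (w \<otimes> a) = Suc (len w)" if "a \<in> S - ?D" for a
      using that len_mult_S[of a w] w by (auto simp: right_descents_def)
    have "?D \<subseteq> S" by (auto simp: right_descents_def)
    then have "(s, t) \<in> (finite_adjacent (S - ?D))\<^sup>*"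
      using conn[OF _ finite_right_descents[OF S w(1)] s t] by blast
    then show ?thesis
    proof (induction rule: rtrancl_induct)
      case base
      then show ?case using asc[OF s] s w by (simp add: joined_def)
    next
      case (step a b)
      then have ab: "a \<in> S - ?D" "b \<in> S - ?D" "m a b \<noteq> \<infinity>" by (auto simp: finite_adjacent_def)
      then have "(w \<otimes> a, w \<otimes> b) \<in> joined ?E (?V (Suc n))"
        using dihedral_detour[of a b w] w asc by (simp add: Suc_le_eq)
      then show ?case by (rule joined_trans[OF step.IH])
    qed
  qed
  have "(u, v) \<in> joined ?E (?V n)" using Suc by simp
  then have path: "(u, v) \<in> (?E \<inter> ?V n \<times> ?V n)\<^sup>*" by (simp add: joined_def)
  \<comment> \<open>A vertex on the sphere of radius \<open>n\<close> is not in the smaller set, so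
    for it the invariant speaks of all its longer neighbours instead. Edges change the length by
    one, so a path in \<open>?V n\<close> enters and leaves the sphere through longer neighbours,
    and \<open>detour\<close> links these.\<close>
  have "if len v = n then (\<forall>s \<in> S - right_descents v. (u, v \<otimes> s) \<in> joined ?E (?V (Suc n)))
      else (u, v) \<in> joined ?E (?V (Suc n))"
    using path
  proof (induction rule: rtrancl_induct)
    case base
    then show ?case using Suc.prems by (auto simp: joined_def)
  next
    case (step v w)
    have vw: "v \<in> carrier W" "w \<in> carrier W" "n \<le> len v" "n \<le> len w" using step.hyps by auto
    obtain s where s: "s \<in> S" "w = v \<otimes> s"
      using step.hyps(2) cayley_edges_iff[OF S_carrier] by auto
    then have v: "v = w \<otimes> s" using vw by simp
    consider "len v = n" "len w = Suc n" | "len v = Suc n" "len w = n" | "len v \<noteq> n" "len w \<noteq> n"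
      using len_mult_S[OF s(1) vw(1), folded s(2)] vw(3,4)
      by (cases "len v = n"; cases "len w = n") auto
    then show ?case
    proof cases
      case 1
      then have "s \<in> S - right_descents v" using s by (simp add: right_descents_def)
      then have "(u, v \<otimes> s) \<in> joined ?E (?V (Suc n))" using step.IH 1(1) by simp
      then show ?thesis using 1(2) by (simp add: s(2)[symmetric])
    next
      case 2
      then have s': "s \<in> S - right_descents w" using s(1) 2 by (simp add: right_descents_def v[symmetric])
      have "(v, w \<otimes> t) \<in> joined ?E (?V (Suc n))" if "t \<in> S - right_descents w" for t
        using detour[OF vw(2) 2(2) s' that, folded v] .
      moreover have "(u, v) \<in> joined ?E (?V (Suc n))" using step.IH 2 by simp
      ultimately have "\<forall>t \<in> S - right_descents w. (u, w \<otimes> t) \<in> joined ?E (?V (Suc n))"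
        using joined_trans by fast
      then show ?thesis using 2 by simp
    next
      case 3
      then have "(u, v) \<in> joined ?E (?V (Suc n))" using step.IH by simp
      moreover have "(v, w) \<in> ?E" "w \<in> ?V (Suc n)" using step.hyps 3 vw by auto
      ultimately have "(u, w) \<in> joined ?E (?V (Suc n))" by (rule joined_edge)
      then show ?thesis using 3 by simp
    qed
  qed
  then show ?case using Suc.prems by (simp split: if_splits)
qed

text \<open>Beyond a radius \<open>N\<close> that exceeds all lengths on the frontier of
  \<open>A\<close>, no edge leaves \<open>A\<close>, yet \<open>A\<close> and its complement both
  have elements there. So the hypothesis of \<open>complement_of_ball_connected\<close> must fail
  for some \<open>D\<close>.\<close>

lemma ex_separating:
  assumes S: "finite S" and A: "almost_invariant A" "infinite A" "infinite (carrier W - A)"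
  shows "\<exists>D A B. S = D \<union> A \<union> B \<and> D \<inter> A = {} \<and> D \<inter> B = {} \<and> A \<inter> B = {} \<and> A \<noteq> {} \<and> B \<noteq> {}
    \<and> finite (generate W D) \<and> (\<forall>a \<in> A. \<forall>b \<in> B. m a b = \<infinity>)"
proof -
  have "\<exists>D a b. D \<subseteq> S \<and> finite (generate W D) \<and> a \<in> S - D \<and> b \<in> S - D
    \<and> (a, b) \<notin> (finite_adjacent (S - D))\<^sup>*"
  proof (rule ccontr)
    assume "\<not> ?thesis"
    then have conn: "\<And>D a b. D \<subseteq> S \<Longrightarrow> finite (generate W D) \<Longrightarrow> a \<in> S - D \<Longrightarrow> b \<in> S - D
      \<Longrightarrow> (a, b) \<in> (finite_adjacent (S - D))\<^sup>*"
      by blast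
    have Ac: "A \<subseteq> carrier W" using A(1) by (simp add: almost_invariant_def)
    have "finite (frontier_in S A)" using finite_frontier_in[OF S S_carrier A(1)] .
    then have "finite (len ` frontier_in S A)" by simp
    then obtain N where N: "\<forall>l \<in> len ` frontier_in S A. l < N"
      by (auto simp: finite_nat_set_iff_bounded)
    have "\<exists>u \<in> C. N \<le> len u" if "infinite C" "C \<subseteq> carrier W" for C
    proof (rule ccontr)
      assume "\<not> ?thesis"
      then have "C \<subseteq> {w \<in> carrier W. len w \<le> N}" using that by auto
      then show False using finite_ball[OF S] that finite_subset by blast
    qed
    then obtain u v where u: "u \<in> A" "N \<le> len u" and v: "v \<in> carrier W - A" "N \<le> len v"
      using A Ac by (metis Diff_subset)
    have "(u, v) \<in> joined (cayley_edges W S) {w \<in> carrier W. N \<le> len w}"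
      using complement_of_ball_connected[OF S conn, of u v N] u v Ac by blast
    then have "v \<in> A"
    proof (rule joined_closed)
      fix a b assume ab: "a \<in> A" "(a, b) \<in> cayley_edges W S" "a \<in> {w \<in> carrier W. N \<le> len w}"
      show "b \<in> A"
      proof (rule ccontr)
        assume "b \<notin> A"
        then have "a \<in> frontier_in S A"
          using ab unfolding frontier_in_def cayley_edges_iff[OF S_carrier] by blast
        then show False using N ab by fastforce
      qed
    qed (use u in simp)
    then show False using v by simp
  qed
  then obtain D a b where D: "D \<subseteq> S" "finite (generate W D)" and ab: "a \<in> S - D" "b \<in> S - D"
    and sep: "(a, b) \<notin> (finite_adjacent (S - D))\<^sup>*" by blast
  \<comment> \<open>From here on \<open>A\<close> is a set of generators, the component of
    \<open>a\<close> in the diagram on \<open>S - D\<close>; \<open>B\<close> collects all other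
    components.\<close>
  define A where "A = {x \<in> S - D. (a, x) \<in> (finite_adjacent (S - D))\<^sup>*}"
  define B where "B = S - D - A"
  have "m x y = \<infinity>" if "x \<in> A" "y \<in> B" for x y
  proof (rule ccontr)
    assume "m x y \<noteq> \<infinity>"
    then have "(x, y) \<in> finite_adjacent (S - D)"
      using that by (simp add: finite_adjacent_def A_def B_def)
    then have "y \<in> A"
      using that unfolding A_def B_def by (auto intro: rtrancl.rtrancl_into_rtrancl)
    then show False using that by (simp add: B_def)
  qed
  moreover have "a \<in> A" "b \<in> B" using ab sep by (auto simp: A_def B_def)
  ultimately show ?thesis
    using D by (intro exI[of _ D] exI[of _ A] exI[of _ B]) (auto simp: A_def B_def)
qed


section \<open>Half-spaces over a finite special subgroup\<close>

lemma infinite_unrelated_generate: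
  assumes st: "s \<in> S" "t \<in> S" and inf: "m s t = \<infinity>"
  shows "infinite (generate W {s, t})"
proof
  assume fin: "finite (generate W {s, t})"
  have sub: "subgroup (generate W {s, t}) W" using generate_subgroup st by simp
  let ?p = "s \<otimes> t"
  have "?p \<in> generate W {s, t}" by (intro generate.eng generate.incl) auto
  then have pow: "?p [^] (k :: nat) \<in> generate W {s, t}" for k
    by (induction k) (auto intro: generate.one generate.eng)
  have "inj (\<lambda>k :: nat. ?p [^] k)"
  proof (rule linorder_injI)
    fix i j :: nat assume "i < j"
    have p: "?p \<in> carrier W" using st by simp
    show "?p [^] i \<noteq> ?p [^] j"
    proof
      assume eq: "?p [^] i = ?p [^] j"
      have "?p [^] i \<otimes> ?p [^] (j - i) = ?p [^] j"
        using p \<open>i < j\<close> by (simp add: nat_pow_mult)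
      then have "?p [^] i \<otimes> ?p [^] (j - i) = ?p [^] i"
        unfolding eq .
      then have "?p [^] (j - i) = \<one>"
        using p by simp
      then show False
        using unrelated_infinite_order[OF st inf, of "j - i"] \<open>i < j\<close> by simp
    qed
  qed
  moreover have "range (\<lambda>k :: nat. ?p [^] k) \<subseteq> generate W {s, t}" using pow by blast
  ultimately show False using fin finite_subset range_inj_infinite by blast
qed

text \<open>By exchange \<open>s g\<close> again lies in \<open><T>\<close>; hence so does
  \<open>s\<close>, and a generator in \<open><T>\<close> belongs to \<open>T\<close>.\<close>

lemma left_descent_mem:
  assumes T: "T \<subseteq> S" and g: "g \<in> generate W T" and s: "s \<in> S" and desc: "len (s \<otimes> g) < len g"
  shows "s \<in> T"
proof -
  obtain u where u: "reduced u" "u \<in> lists T" "val u = g" using reduced_word_over[OF T g] .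
  then obtain p a q where paq: "u = p @ a # q" "s \<otimes> g = val (p @ q)"
    using exchange[of u s] reduced_lists s desc by auto
  then have "s \<otimes> g \<in> generate W T" using u generate_val[OF T] by auto
  moreover have "s = (s \<otimes> g) \<otimes> inv g"
    using s generate_closed[OF T g] by (simp add: m_assoc)
  ultimately have "s \<in> generate W T"
    using g generate_subgroup[OF T] by (metis subgroup.m_closed subgroup.m_inv_closed)
  then show ?thesis using generate_Int_S[OF T s] by blast
qed

text \<open>\<open>W\<close> is the amalgam of the special subgroups on \<open>D \<union> A\<close> and \<open>D \<union> B\<close> over the finite one on \<open>D\<close>.
  For \<open>g\<close> in the first factor, \<open>branch D A g\<close> is the half-space of the Bass-Serre tree behind the
  edge \<open>g W\<^sub>D\<close>.\<close>

definition branch :: "'a set \<Rightarrow> 'a set \<Rightarrow> 'a \<Rightarrow> 'a set" where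
  "branch D A g = {g \<otimes> u \<otimes> v | u v. u \<in> generate W D \<and> left_min (D \<union> A) v \<and> v \<noteq> \<one>}"

context
  fixes D A B
  assumes S_fin: "finite S" and S_eq: "S = D \<union> A \<union> B"
    and disj: "D \<inter> A = {}" "D \<inter> B = {}" "A \<inter> B = {}"
    and D_fin: "finite (generate W D)"
    and AB: "\<And>a b. a \<in> A \<Longrightarrow> b \<in> B \<Longrightarrow> m a b = \<infinity>"
begin

text \<open>Let \<open>w = g u v\<close> and multiply by a generator \<open>s\<close>. If
  \<open>v s\<close> is again a representative, \<open>w\<close> leaves the branch only when
  \<open>v = s\<close>. Otherwise \<open>v s = t v\<close> by \<open>deodhar\<close>, and a
  \<open>t\<close> in \<open>D\<close> is absorbed into \<open>u\<close>. Once \<open>t\<close> in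
  \<open>A\<close> is excluded, only the finitely many \<open>g u s\<close> can leave.\<close>

lemma branch_almost_invariant:
  assumes g: "g \<in> carrier W"
  shows "almost_invariant (branch D A g)"
proof -
  let ?Z = "branch D A g" and ?T = "D \<union> A"
  have T: "?T \<subseteq> S" and DS: "D \<subseteq> S" using S_eq by auto
  have Dc: "generate W D \<subseteq> carrier W" using generate_closed[OF DS] by blast
  have Z: "?Z \<subseteq> carrier W"
    using g Dc by (auto simp: branch_def left_min_def)
  have fin: "finite {w \<in> ?Z. w \<otimes> s \<notin> ?Z}" if s: "s \<in> S" for s
  proof (rule finite_subset)
    show "finite ((\<lambda>u. g \<otimes> u \<otimes> s) ` generate W D)" using D_fin by simp
    show "{w \<in> ?Z. w \<otimes> s \<notin> ?Z} \<subseteq> (\<lambda>u. g \<otimes> u \<otimes> s) ` generate W D"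
    proof
      fix w assume w: "w \<in> {w \<in> ?Z. w \<otimes> s \<notin> ?Z}"
      then obtain u v where u: "u \<in> generate W D" and v: "left_min ?T v" "v \<noteq> \<one>"
        and w_eq: "w = g \<otimes> u \<otimes> v"
        by (auto simp: branch_def)
      have uc: "u \<in> carrier W" and vc: "v \<in> carrier W" using u Dc v by (auto simp: left_min_def)
      have ws: "w \<otimes> s = g \<otimes> u \<otimes> (v \<otimes> s)" using w_eq g uc vc s by (simp add: m_assoc)
      show "w \<in> (\<lambda>u. g \<otimes> u \<otimes> s) ` generate W D"
      proof (cases "left_min ?T (v \<otimes> s)")
        case True
        then have "v \<otimes> s = \<one>" using w ws u unfolding branch_def by blast
        then have "v = s" using s vc S_cancel_right[of s v] by simp
        then show ?thesis using w_eq u by blast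
      next
        case False
        then obtain t where t: "t \<in> ?T" and vs: "v \<otimes> s = t \<otimes> v" "len (v \<otimes> s) = Suc (len v)"
          using deodhar[OF T v(1) s] by blast
        have tS: "t \<in> S" using t T by blast
        have "t \<in> D"
        proof (rule ccontr)
          \<comment> \<open>A reduced word for \<open>v\<close> begins with a letter
            \<open>b\<close> outside \<open>D \<union> A\<close>, hence in \<open>B\<close>. Both
            \<open>t\<close> and \<open>b\<close> are left descents of \<open>v s\<close>, so they
            would generate a finite group although they are unrelated.\<close>
          assume "t \<notin> D"
          then have tA: "t \<in> A" using t by simp
          obtain x where x: "reduced x" "val x = v" using reduced_word[OF vc] .
          obtain b y where xb: "x = b # y" using x v(2) by (cases x) auto
          have b: "b \<in> S" and y: "y \<in> lists S" using reduced_lists[OF x(1)] xb by auto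
          have bv: "b \<otimes> v = val y" using x(2) xb b y by (simp flip: x(2))
          have "len v = Suc (length y)" using x xb by (simp add: reduced_def)
          then have bv_len: "len (b \<otimes> v) < len v" using len_le[OF y] bv by simp
          then have "b \<notin> ?T" using v(1) by (auto simp: left_min_def)
          then have bB: "b \<in> B" using b S_eq by blast
          have "len (b \<otimes> v \<otimes> s) \<le> len (b \<otimes> v) + 1"
            using len_mult_le[of "b \<otimes> v" s] b s vc by simp
          then have "len (b \<otimes> (v \<otimes> s)) < len (v \<otimes> s)"
            using bv_len vs(2) b s vc by (simp add: m_assoc)
          moreover have "len (t \<otimes> (v \<otimes> s)) < len (v \<otimes> s)"
            using vs tS vc by simp
          ultimately have "finite (generate W {t, b})"
            using tS b s vc by (intro finite_left_descents[OF S_fin, of _ "v \<otimes> s"]) auto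
          then show False
            using infinite_unrelated_generate[OF tS b AB[OF tA bB]] by blast
        qed
        then have "u \<otimes> t \<in> generate W D" using generate.eng[OF u generate.incl] by blast
        moreover have "w \<otimes> s = g \<otimes> (u \<otimes> t) \<otimes> v"
          using ws vs(1) g uc tS vc by (simp add: m_assoc)
        ultimately have "w \<otimes> s \<in> ?Z" using v unfolding branch_def by blast
        then show ?thesis using w by simp
      qed
    qed
  qed
  show ?thesis
    using almost_invariant_generate[OF generate_S S_carrier Z] fin by simp
qed

text \<open>For \<open>a\<close> in \<open>A\<close> and \<open>b\<close> in \<open>B\<close> the
  group \<open><a, b>\<close> is infinite, and within \<open>D \<union> A\<close> only
  \<open>a\<close> can be a left descent of its elements. So for each element \<open>x\<close>, one
  of \<open>x\<close> and \<open>a x\<close> is a representative, which makes infinitely many of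
  them.\<close>

lemma infinite_branch:
  assumes g: "g \<in> carrier W" and ne: "A \<noteq> {}" "B \<noteq> {}"
  shows "infinite (branch D A g)"
proof
  let ?T = "D \<union> A"
  assume fin: "finite (branch D A g)"
  have T: "?T \<subseteq> S" using S_eq by auto
  obtain a b where a: "a \<in> A" and b: "b \<in> B" using ne by blast
  have ab: "a \<in> S" "b \<in> S" using a b S_eq by auto
  have abS: "{a, b} \<subseteq> S" using ab by simp
  define L where "L = {v \<in> carrier W. left_min ?T v}"
  have "(\<lambda>v. g \<otimes> v) ` (L - {\<one>}) \<subseteq> branch D A g"
  proof
    fix w assume "w \<in> (\<lambda>v. g \<otimes> v) ` (L - {\<one>})"
    then obtain v where v: "v \<in> L" "v \<noteq> \<one>" "w = g \<otimes> \<one> \<otimes> v" using g by auto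
    then show "w \<in> branch D A g"
      using generate.one[of W D] unfolding branch_def L_def by blast
  qed
  then have "finite ((\<lambda>v. g \<otimes> v) ` (L - {\<one>}))" using fin finite_subset by blast
  moreover have "inj_on (\<lambda>v. g \<otimes> v) (L - {\<one>})" using g by (auto simp: inj_on_def L_def)
  ultimately have "finite (L - {\<one>})" using finite_imageD by blast
  then have L: "finite L" by simp
  have "generate W {a, b} \<subseteq> L \<union> (\<lambda>v. a \<otimes> v) ` L"
  proof
    fix x assume x: "x \<in> generate W {a, b}"
    have descent: "t = a" if "t \<in> ?T" "y \<in> generate W {a, b}" "len (t \<otimes> y) < len y" for t y
      using left_descent_mem[OF abS that(2) subsetD[OF T that(1)] that(3)] that(1) b disj by auto
    have not_desc: "len (t \<otimes> y) = Suc (len y)"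
      if "t \<in> ?T" "y \<in> generate W {a, b}" "\<not> len (t \<otimes> y) < len y" for t y
      using len_S_mult[of t y] that T generate_closed[OF abS that(2)] by auto
    have xc: "x \<in> carrier W" using generate_closed[OF abS x] .
    show "x \<in> L \<union> (\<lambda>v. a \<otimes> v) ` L"
    proof (cases "len (a \<otimes> x) < len x")
      case False
      have "left_min ?T x"
        unfolding left_min_def using not_desc[OF _ x] descent[OF _ x] False xc by blast
      then show ?thesis using xc by (simp add: L_def)
    next
      case True
      have ax: "a \<otimes> x \<in> generate W {a, b}" using generate.eng[OF generate.incl x] by simp
      have axc: "a \<otimes> x \<in> carrier W" using generate_closed[OF abS ax] .
      have "\<not> len (a \<otimes> (a \<otimes> x)) < len (a \<otimes> x)" using True ab xc by simp
      then have "left_min ?T (a \<otimes> x)"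
        unfolding left_min_def using not_desc[OF _ ax] descent[OF _ ax] axc by blast
      then have "a \<otimes> x \<in> L" using axc by (simp add: L_def)
      moreover have "x = a \<otimes> (a \<otimes> x)" using ab xc by simp
      ultimately show ?thesis by blast
    qed
  qed
  then have "finite (generate W {a, b})" using L finite_subset by blast
  then show False using infinite_unrelated_generate[OF ab AB[OF a b]] by blast
qed

text \<open>By \<open>left_min_unique\<close>, a common element has the same part in
  \<open><D \<union> A>\<close> in both descriptions, that is, \<open>g u = h u'\<close>.\<close>

lemma branch_disjoint:
  assumes g: "g \<in> generate W (D \<union> A)" "h \<in> generate W (D \<union> A)" and nin: "inv g \<otimes> h \<notin> generate W D"
  shows "branch D A g \<inter> branch D A h = {}"
proof (rule ccontr)
  let ?T = "D \<union> A"
  have T: "?T \<subseteq> S" and DS: "D \<subseteq> S" using S_eq by auto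
  assume "branch D A g \<inter> branch D A h \<noteq> {}"
  then obtain u v u' v' where u: "u \<in> generate W D" "u' \<in> generate W D"
    and v: "left_min ?T v" "left_min ?T v'" and eq: "g \<otimes> u \<otimes> v = h \<otimes> u' \<otimes> v'"
    unfolding branch_def by blast
  have c: "u \<in> carrier W" "u' \<in> carrier W" "g \<in> carrier W" "h \<in> carrier W"
    using u g generate_closed[OF DS] generate_closed[OF T] by auto
  have "u \<in> generate W ?T" "u' \<in> generate W ?T"
    using u mono_generate[of D ?T] by auto
  then have "g \<otimes> u \<in> generate W ?T" "h \<otimes> u' \<in> generate W ?T"
    using g by (auto intro: generate.eng)
  then have "g \<otimes> u = h \<otimes> u'"
    using left_min_unique[OF T _ _ v eq] by blast
  then have "inv g \<otimes> (h \<otimes> u') = u" using c by (metis mult_inv_cancel(2))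
  then have "inv g \<otimes> h \<otimes> u' = u" using c by (simp add: m_assoc)
  then have "inv g \<otimes> h = u \<otimes> inv u'" using c by (metis inv_closed inv_solve_right m_closed)
  moreover have "u \<otimes> inv u' \<in> generate W D"
    using u generate_subgroup[OF DS] by (simp add: subgroup.m_closed subgroup.m_inv_closed)
  ultimately show False using nin by simp
qed

text \<open>Otherwise the branches at \<open>1\<close>, \<open>g\<close> and \<open>h\<close> would
  be three disjoint infinite almost invariant sets. In effect \<open><D>\<close> has index at most 2
  in \<open><D \<union> A>\<close>.\<close>

lemma two_ended_index:
  assumes two: "two_ended W" and ne: "A \<noteq> {}" "B \<noteq> {}"
    and g: "g \<in> generate W (D \<union> A)" "g \<notin> generate W D"
    and h: "h \<in> generate W (D \<union> A)" "h \<notin> generate W D"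
  shows "inv g \<otimes> h \<in> generate W D"
proof (rule ccontr)
  assume n: "inv g \<otimes> h \<notin> generate W D"
  obtain X where X: "finite X" "X \<subseteq> carrier W" "generate W X = carrier W"
    and card: "card (graph_ends (cayley_edges W X)) = 2"
    using two unfolding two_ended_def by blast
  have T: "D \<union> A \<subseteq> S" using S_eq by auto
  have c: "g \<in> carrier W" "h \<in> carrier W" using generate_closed[OF T] g h by auto
  note three = three_almost_invariant_not_two_ends[OF X
      branch_almost_invariant[OF one_closed] infinite_branch[OF one_closed ne]
      branch_almost_invariant[OF c(1)] infinite_branch[OF c(1) ne]
      branch_almost_invariant[OF c(2)] infinite_branch[OF c(2) ne]]
  show False
    using three card branch_disjoint[OF generate.one g(1)] branch_disjoint[OF generate.one h(1)]
      branch_disjoint[OF g(1) h(1) n] c g(2) h(2) by simp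
qed

lemma two_ended_side:
  assumes two: "two_ended W" and ne: "A \<noteq> {}" "B \<noteq> {}"
  shows "\<exists>a. A = {a} \<and> (\<forall>d \<in> D. m a d = 2)"
proof -
  have T: "D \<union> A \<subseteq> S" and DS: "D \<subseteq> S" using S_eq by auto
  have sub: "subgroup (generate W D) W" using generate_subgroup[OF DS] .
  have aS: "a \<in> S" and aD: "a \<notin> generate W D" and aT: "a \<in> generate W (D \<union> A)" if "a \<in> A" for a
    using that S_eq generate_Int_S[OF DS, of a] disj(1) by (auto intro: generate.incl)
  note index = two_ended_index[OF two ne]
  have unique: "a = a'" if "a \<in> A" "a' \<in> A" for a a'
  proof (rule ccontr)
    assume "a \<noteq> a'"
    let ?D' = "insert a' D"
    have D': "?D' \<subseteq> S" using DS aS that by simp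
    have "a \<otimes> a' \<in> generate W D"
      using index[OF aT[OF that(1)] aD[OF that(1)] aT[OF that(2)] aD[OF that(2)]] aS that by simp
    then have "a \<otimes> a' \<in> generate W ?D'" using mono_generate[of D ?D'] by blast
    then have "a \<otimes> a' \<otimes> a' \<in> generate W ?D'"
      by (rule generate.eng) (auto intro: generate.incl)
    then have "a \<in> generate W ?D'" using aS[OF that(1)] aS[OF that(2)] by simp
    then have "a \<in> ?D'" using generate_Int_S[OF D' aS[OF that(1)]] by blast
    then show False using \<open>a \<noteq> a'\<close> that disj(1) by blast
  qed
  obtain a where a: "a \<in> A" using ne by blast
  have "m a d = 2" if d: "d \<in> D" for d
  proof -
    have S: "a \<in> S" "d \<in> S" using aS[OF a] d DS by auto
    have ad: "a \<noteq> d" using a d disj(1) by blast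
    have dg: "d \<in> generate W D" using d by (rule generate.incl)
    have "d \<otimes> a \<notin> generate W D"
    proof
      assume "d \<otimes> a \<in> generate W D"
      then have "d \<otimes> (d \<otimes> a) \<in> generate W D" by (rule generate.eng[OF dg])
      then show False using aD[OF a] S by simp
    qed
    moreover have "d \<otimes> a \<in> generate W (D \<union> A)"
      using a d by (intro generate.eng generate.incl) auto
    ultimately have "inv a \<otimes> (d \<otimes> a) \<in> generate W D"
      using index[OF aT[OF a] aD[OF a]] by blast
    \<comment> \<open>Since \<open>a\<close> is not a left descent of any element of
      \<open><D>\<close>, the product \<open>a x = d a\<close> is longer than \<open>x\<close>. So
      \<open>x\<close> has length at most 1, and by parity it is a generator \<open>e\<close>; lying
      in \<open>D\<close> and in \<open><a, d>\<close>, it equals \<open>d\<close>, whence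
      \<open>a d = d a\<close>.\<close>
    define x where "x = a \<otimes> (d \<otimes> a)"
    have x: "x \<in> generate W D"
      using \<open>inv a \<otimes> (d \<otimes> a) \<in> generate W D\<close> S by (simp add: x_def)
    have xc: "x \<in> carrier W" using S by (simp add: x_def)
    have ax: "a \<otimes> x = d \<otimes> a" using S by (simp add: x_def)
    have "\<not> len (a \<otimes> x) < len x"
      using left_descent_mem[OF DS x S(1)] a disj(1) by blast
    then have "len (d \<otimes> a) = Suc (len x)"
      using len_S_mult[OF S(1) xc] ax by auto
    moreover have "len (d \<otimes> a) \<le> 2" using len_mult_le[of d a] S by simp
    moreover have "odd (len x)"
      using len_parity[of a "d \<otimes> a"] len_parity[of d a] S by (simp add: x_def)
    ultimately have "len x = 1" by presburger
    obtain u where u: "reduced u" "u \<in> lists D" "val u = x" using reduced_word_over[OF DS x] .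
    then have "length u = 1" using \<open>len x = 1\<close> by (simp add: reduced_def)
    then obtain e where e: "u = [e]" by (metis One_nat_def length_0_conv length_Suc_conv)
    then have eD: "e \<in> D" "x = e" using u DS by auto
    have "x \<in> generate W {a, d}"
      unfolding x_def by (intro generate.eng generate.incl) auto
    then have "e \<in> {a, d}"
      using generate_Int_S[of "{a, d}" e] eD S DS by auto
    then have "e = d" using eD a disj(1) by blast
    then have "a \<otimes> d = d \<otimes> a" using ax eD by simp
    then show "m a d = 2" using commute_imp_m_two[OF S ad] by blast
  qed
  then show ?thesis using a unique by (intro exI[of _ a]) blast
qed

end

lemma two_ended_structure:
  assumes two: "two_ended W"
  shows "\<exists>x y D. S = {x, y} \<union> D \<and> x \<noteq> y \<and> x \<notin> D \<and> y \<notin> D \<and> m x y = \<infinity>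
    \<and> finite (generate W D) \<and> (\<forall>d \<in> D. m x d = 2 \<and> m y d = 2)"
proof -
  obtain X where X: "finite X" "X \<subseteq> carrier W" "generate W X = carrier W"
    and card: "card (graph_ends (cayley_edges W X)) = 2"
    using two unfolding two_ended_def by blast
  have S: "finite S" using finite_generators X by blast
  obtain Z where "almost_invariant Z" "infinite Z" "infinite (carrier W - Z)"
    using two_ends_almost_invariant[OF X(2,3) card] by blast
  from ex_separating[OF S this] obtain D A B where
    eq: "S = D \<union> A \<union> B" and disj: "D \<inter> A = {}" "D \<inter> B = {}" "A \<inter> B = {}"
    and ne: "A \<noteq> {}" "B \<noteq> {}" and fin: "finite (generate W D)"
    and inf: "\<forall>a \<in> A. \<forall>b \<in> B. m a b = \<infinity>" by blast
  obtain x where x: "A = {x}" "\<forall>d \<in> D. m x d = 2"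
    using two_ended_side[OF S eq disj fin _ two ne] inf by blast
  have "m b a = \<infinity>" if "b \<in> B" "a \<in> A" for a b
    using that inf m_sym[of a b] eq by auto
  \<comment> \<open>The same result with the two sides exchanged.\<close>
  then obtain y where y: "B = {y}" "\<forall>d \<in> D. m y d = 2"
    using two_ended_side[OF S _ disj(2,1) _ fin _ two ne(2,1)] eq disj by blast
  show ?thesis
    using eq disj x y fin inf by (intro exI[of _ x] exI[of _ y] exI[of _ D]) auto
qed

end

section \<open>Products with a finite group\<close>

lemma presented_eq_mono:
  assumes "presented_eq X R u v" "X \<subseteq> Y" "R \<subseteq> Q"
  shows "presented_eq Y Q u v"
  using assms(1)
  by induction (use assms(2,3) in \<open>auto intro: presented_eq.intros\<close>)

lemma coxeter_relators_mono: "T \<subseteq> S \<Longrightarrow> coxeter_relators T m \<subseteq> coxeter_relators S m"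
  unfolding coxeter_relators_def by blast

lemma coxeter_relators_cong:
  assumes "\<And>s t. s \<in> T \<Longrightarrow> t \<in> T \<Longrightarrow> m s t = m' s t"
  shows "coxeter_relators T m = coxeter_relators T m'"
  unfolding coxeter_relators_def using assms by (metis (no_types, opaque_lifting))

context coxeter_system
begin

text \<open>The relators on \<open>T\<close> also hold in \<open>W\<close>, so the value of a word
  in \<open>G\<close> determines its value in \<open>W\<close>; this exhibits \<open><T>\<close> as
  an image of \<open>G\<close>.\<close>

lemma finite_generate_of_finite_group:
  assumes G: "coxeter_system G T n" and T: "T \<subseteq> S"
    and eq: "\<And>s t. s \<in> T \<Longrightarrow> t \<in> T \<Longrightarrow> n s t = m s t"
    and fin: "finite (carrier G)"
  shows "finite (generate W T)"
proof -
  let ?v = "coxeter_system.val G"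
  have "val u = val v" if "u \<in> lists T" "v \<in> lists T" "?v u = ?v v" for u v
  proof -
    have "presented_eq T (coxeter_relators T n) (map (\<lambda>s. (s, True)) u) (map (\<lambda>s. (s, True)) v)"
      using coxeter_system.val_eq_iff[OF G that(1,2)] that(3) by simp
    then have "presented_eq S (coxeter_relators S m) (map (\<lambda>s. (s, True)) u) (map (\<lambda>s. (s, True)) v)"
      using T coxeter_relators_cong[of T n m, OF eq] coxeter_relators_mono[OF T, of m]
      by (auto intro: presented_eq_mono)
    then show ?thesis
      using val_eq_iff that lists_mono[OF T] by blast
  qed
  then have "\<exists>f. \<forall>u \<in> lists T. val u = f (?v u)"
    by (intro exI[of _ "\<lambda>g. val (SOME u. u \<in> lists T \<and> ?v u = g)"] ballI)
      (metis (mono_tags, lifting) someI_ex)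
  then obtain f where f: "\<And>u. u \<in> lists T \<Longrightarrow> val u = f (?v u)" by blast
  have "generate W T \<subseteq> f ` carrier G"
    unfolding generate_val[OF T] using f coxeter_system.val_closed[OF G] by blast
  then show ?thesis using fin finite_subset by blast
qed

section \<open>Splitting off the unrelated pair\<close>

context
  fixes x y H
  assumes S_eq: "S = {x, y} \<union> H" and xyH: "x \<notin> H" "y \<notin> H" and unrel: "m x y = \<infinity>"
    and two: "\<And>h. h \<in> H \<Longrightarrow> m x h = 2 \<and> m y h = 2"
begin

lemma H_S: "H \<subseteq> S" and x_S: "x \<in> S" and y_S: "y \<in> S"
  using S_eq by auto

lemma presented_eq_square:
  assumes "h \<in> H"
  shows "presented_eq H (coxeter_relators H m) [(h, True), (h, True)] []"
proof (rule presented_eq.relator)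
  have "m h h = enat 1" using m_one_iff[of h h] assms H_S by (auto simp: one_enat_def)
  then show "[(h, True), (h, True)] \<in> coxeter_relators H m"
    unfolding coxeter_relators_def using assms
    by (intro CollectI exI[of _ h] exI[of _ 1]) auto
qed

text \<open>Deleting the letters \<open>x\<close> and \<open>y\<close> respects the relations: the relators \<open>(x h)\<^sup>2\<close> become \<open>h\<^sup>2\<close>,
  and \<open>x\<close>, \<open>y\<close> are unrelated.\<close>

lemma retraction:
  assumes "u \<in> lists S" "v \<in> lists S" "val u = val v"
  shows "presented_eq H (coxeter_relators H m)
    (map (\<lambda>s. (s, True)) (filter (\<lambda>s. s \<in> H) u)) (map (\<lambda>s. (s, True)) (filter (\<lambda>s. s \<in> H) v))"
proof -
  let ?w = "\<lambda>u. map (\<lambda>s. (s, True)) (filter (\<lambda>s. s \<in> H) u)"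
  let ?eq = "presented_eq H (coxeter_relators H m)"
  \<comment> \<open>The conclusion of \<open>word_invariant\<close> is an equality, so the relation
    is encoded by its classes.\<close>
  define F where "F = (\<lambda>u. {w. ?eq (?w u) w})"
  have F_iff: "F u = F v \<longleftrightarrow> ?eq (?w u) (?w v)" for u v
    unfolding F_def
    by (auto intro: presented_eq.intros)
  have "F u = F v"
  proof (rule word_invariant[OF _ _ _ assms])
    fix p u v q assume "F u = F v"
    then show "F (p @ u @ q) = F (p @ v @ q)"
      unfolding F_iff by (simp add: presented_eq.in_context)
  next
    fix s assume "s \<in> S"
    show "F [s, s] = F []"
      unfolding F_iff using presented_eq_square[of s] presented_eq.reflexive by (cases "s \<in> H") auto
  next
    fix s t n assume st: "s \<in> S" "t \<in> S" and n: "m s t = enat n" and ne: "s \<noteq> t"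
    consider "s \<in> H" "t \<in> H" | "s \<in> H" "t \<notin> H" | "s \<notin> H" "t \<in> H" | "s \<notin> H" "t \<notin> H" by blast
    then show "F (concat (replicate n [s, t])) = F []"
    proof cases
      case 1
      then have "concat (replicate n [(s, True), (t, True)]) \<in> coxeter_relators H m"
        unfolding coxeter_relators_def using n by blast
      moreover have "?w (concat (replicate n [s, t])) = concat (replicate n [(s, True), (t, True)])"
        using 1 by (induction n) auto
      ultimately show ?thesis unfolding F_iff by (simp add: presented_eq.relator)
    next
      case 2
      then have "m s t = 2" using two st m_sym[OF st] S_eq by auto
      then have "n = 2" using n by (simp add: numeral_eq_enat)
      then show ?thesis
        unfolding F_iff using 2 presented_eq_square[of s] by (simp add: numeral_2_eq_2)
    next
      case 3
      then have "m s t = 2" using two st S_eq by auto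
      then have "n = 2" using n by (simp add: numeral_eq_enat)
      then show ?thesis
        unfolding F_iff using 3 presented_eq_square[of t] by (simp add: numeral_2_eq_2)
    next
      case 4
      then have "m s t = \<infinity>" using st ne S_eq unrel m_sym[OF x_S y_S] by auto
      then show ?thesis using n by simp
    qed
  qed
  then show ?thesis unfolding F_iff .
qed

text \<open>A word over \<open>{x, y}\<close> retracts to the empty word and a word over
  \<open>H\<close> to itself; if their values agree, the latter is trivial already modulo the
  relators on \<open>H\<close>.\<close>

lemma generate_xy_Int_H: "generate W {x, y} \<inter> generate W H \<subseteq> {\<one>}"
proof
  fix g assume g: "g \<in> generate W {x, y} \<inter> generate W H"
  have xyS: "{x, y} \<subseteq> S" using x_S y_S by simp
  have "g \<in> val ` lists {x, y}" "g \<in> val ` lists H"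
    using g generate_val[OF xyS] generate_val[OF H_S] by simp_all
  then obtain u v where u: "u \<in> lists {x, y}" "val u = g" and v: "v \<in> lists H" "val v = g"
    by (metis imageE)
  have uS: "u \<in> lists S" and vS: "v \<in> lists S"
    using u v lists_mono[OF xyS] lists_mono[OF H_S] by blast+
  have "filter (\<lambda>s. s \<in> H) u = []"
    using u(1) xyH by (induction u) auto
  moreover have "filter (\<lambda>s. s \<in> H) v = v"
    using v(1) by (induction v) auto
  ultimately have "presented_eq H (coxeter_relators H m) (map (\<lambda>s. (s, True)) []) (map (\<lambda>s. (s, True)) v)"
    using retraction[OF uS vS] u v by simp
  then have "presented_eq S (coxeter_relators S m) (map (\<lambda>s. (s, True)) []) (map (\<lambda>s. (s, True)) v)"
    using H_S coxeter_relators_mono[OF H_S] by (rule presented_eq_mono)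
  then have "val [] = val v" using val_eq_iff[OF _ vS] by blast
  then show "g \<in> {\<one>}" using v by simp
qed

lemma generator_commutes:
  assumes "s \<in> {x, y}" "h \<in> H"
  shows "s \<otimes> h = h \<otimes> s"
proof -
  have sS: "s \<in> S" "h \<in> S" using assms S_eq by auto
  have "m s h = enat 2" using assms two by (auto simp: numeral_eq_enat)
  then have "(s \<otimes> h) \<otimes> (s \<otimes> h) = \<one>"
    using relation[OF sS] sS by (simp add: numeral_2_eq_2)
  then have "inv (s \<otimes> h) = s \<otimes> h" using sS by (simp add: inv_equality)
  then show ?thesis using sS by (simp add: inv_mult_group)
qed

lemma generate_commute:
  assumes a: "a \<in> generate W {x, y}" and b: "b \<in> generate W H"
  shows "a \<otimes> b = b \<otimes> a"
proof -
  have xyS: "{x, y} \<subseteq> S" using x_S y_S by simp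
  have one: "s \<otimes> val v = val v \<otimes> s" if "v \<in> lists H" "s \<in> {x, y}" for s v
    using that(1)
  proof (induction v rule: list.induct)
    case Nil
    then show ?case using that(2) x_S y_S by auto
  next
    case (Cons h v)
    have h: "h \<in> H" and vH: "v \<in> lists H" using Cons.prems by auto
    have "v \<in> lists S" using vH lists_mono[OF H_S] by blast
    then have c: "s \<in> carrier W" "h \<in> carrier W" "val v \<in> carrier W"
      using that(2) x_S y_S h H_S by auto
    have "s \<otimes> (h \<otimes> val v) = (s \<otimes> h) \<otimes> val v" using c by (simp add: m_assoc)
    also have "\<dots> = h \<otimes> (s \<otimes> val v)"
      using c generator_commutes[OF that(2) h] by (simp add: m_assoc)
    also have "\<dots> = h \<otimes> val v \<otimes> s" using c Cons.IH[OF vH] by (simp add: m_assoc)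
    finally show ?case by simp
  qed
  have "b \<in> val ` lists H" using b generate_val[OF H_S] by simp
  then obtain v where v: "v \<in> lists H" "b = val v" by (metis imageE)
  have comm: "val u \<otimes> b = b \<otimes> val u" if "u \<in> lists {x, y}" for u
    using that
  proof (induction u rule: list.induct)
    case Nil
    then show ?case using generate_closed[OF H_S b] by simp
  next
    case (Cons s u)
    then have s: "s \<in> {x, y}" and u: "u \<in> lists {x, y}" by auto
    have "u \<in> lists S" using u lists_mono[OF xyS] by blast
    then have c: "s \<in> carrier W" "val u \<in> carrier W" "b \<in> carrier W"
      using s x_S y_S generate_closed[OF H_S b] by auto
    have sb: "s \<otimes> b = b \<otimes> s" using one[OF v(1) s] v(2) by simp
    have "s \<otimes> val u \<otimes> b = s \<otimes> (b \<otimes> val u)" using Cons.IH[OF u] c by (simp add: m_assoc)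
    also have "\<dots> = (s \<otimes> b) \<otimes> val u" using c by (simp add: m_assoc)
    also have "\<dots> = b \<otimes> (s \<otimes> val u)" unfolding sb using c by (simp add: m_assoc)
    finally show ?case by simp
  qed
  have "a \<in> val ` lists {x, y}" using a generate_val[OF xyS] by simp
  then show ?thesis using comm by (metis imageE)
qed

lemma product_decomposition:
  "internal_direct_product W (generate W {x, y}) (generate W H)"
proof -
  have xyS: "{x, y} \<subseteq> S" using x_S y_S by simp
  let ?A = "generate W {x, y}" and ?B = "generate W H"
  have sub: "subgroup ?A W" "subgroup ?B W"
    using generate_subgroup xyS H_S by auto
  have c: "a \<in> carrier W" if "a \<in> ?A" for a using generate_closed[OF xyS that] .
  have d: "b \<in> carrier W" if "b \<in> ?B" for b using generate_closed[OF H_S that] .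
  have "(\<lambda>(a, b). a \<otimes> b) \<in> iso (W\<lparr>carrier := ?A\<rparr> \<times>\<times> W\<lparr>carrier := ?B\<rparr>) W"
  proof (rule isoI)
    show "(\<lambda>(a, b). a \<otimes> b) \<in> hom (W\<lparr>carrier := ?A\<rparr> \<times>\<times> W\<lparr>carrier := ?B\<rparr>) W"
    proof (rule homI)
      fix p q
      assume "p \<in> carrier (W\<lparr>carrier := ?A\<rparr> \<times>\<times> W\<lparr>carrier := ?B\<rparr>)"
        "q \<in> carrier (W\<lparr>carrier := ?A\<rparr> \<times>\<times> W\<lparr>carrier := ?B\<rparr>)"
      then obtain a b a' b' where pq: "p = (a, b)" "q = (a', b')"
        and ab: "a \<in> ?A" "a' \<in> ?A" "b \<in> ?B" "b' \<in> ?B"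
        by (auto simp: DirProd_def)
      have "a \<otimes> a' \<otimes> (b \<otimes> b') = a \<otimes> (a' \<otimes> b) \<otimes> b'"
        using ab c d by (simp add: m_assoc)
      also have "\<dots> = a \<otimes> b \<otimes> (a' \<otimes> b')"
        unfolding generate_commute[OF ab(2,3)] using ab c d by (simp add: m_assoc)
      finally show "(\<lambda>(a, b). a \<otimes> b) (p \<otimes>\<^bsub>W\<lparr>carrier := ?A\<rparr> \<times>\<times> W\<lparr>carrier := ?B\<rparr>\<^esub> q)
          = (\<lambda>(a, b). a \<otimes> b) p \<otimes> (\<lambda>(a, b). a \<otimes> b) q"
        by (simp add: pq DirProd_def)
    qed (use c d in \<open>auto simp: DirProd_def\<close>)
    have "inj_on (\<lambda>(a, b). a \<otimes> b) (?A \<times> ?B)"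
    proof (rule inj_onI, clarify)
      fix a b a' b' assume ab: "a \<in> ?A" "a' \<in> ?A" "b \<in> ?B" "b' \<in> ?B" and eq: "a \<otimes> b = a' \<otimes> b'"
      have "inv a' \<otimes> (a \<otimes> b) = b'" using eq ab c d by simp
      then have "inv a' \<otimes> a = b' \<otimes> inv b"
        using ab c d by (metis inv_closed inv_solve_right m_assoc m_closed)
      moreover have "inv a' \<otimes> a \<in> ?A" "b' \<otimes> inv b \<in> ?B"
        using ab sub by (simp_all add: subgroup.m_closed subgroup.m_inv_closed)
      ultimately have "inv a' \<otimes> a = \<one>" using generate_xy_Int_H by auto
      then have "a' \<otimes> (inv a' \<otimes> a) = a'" using ab c by simp
      then have "a = a'" using ab c by simp
      then show "a = a' \<and> b = b'" using eq ab c d by simp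
    qed
    moreover have "(\<lambda>(a, b). a \<otimes> b) ` (?A \<times> ?B) = carrier W"
    proof
      show "(\<lambda>(a, b). a \<otimes> b) ` (?A \<times> ?B) \<subseteq> carrier W" using c d by auto
      have "\<exists>a \<in> ?A. \<exists>b \<in> ?B. val u = a \<otimes> b" if "u \<in> lists S" for u
        using that
      proof (induction u rule: list.induct)
        case Nil
        then show ?case
          by (intro bexI[of _ \<one>]) (auto intro: generate.one)
      next
        case (Cons s u)
        then have s: "s \<in> S" and "u \<in> lists S" by auto
        then obtain a b where ab: "a \<in> ?A" "b \<in> ?B" "val u = a \<otimes> b" using Cons.IH by blast
        consider "s \<in> {x, y}" | "s \<in> H" using s S_eq by blast
        then show ?case
        proof cases
          case 1
          have "s \<otimes> a \<in> ?A" using generate.eng[OF generate.incl[OF 1] ab(1)] .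
          moreover have "val (s # u) = (s \<otimes> a) \<otimes> b" using ab s c d by (simp add: m_assoc)
          ultimately show ?thesis using ab by blast
        next
          case 2
          have sB: "s \<in> ?B" using 2 by (rule generate.incl)
          have "val (s # u) = (s \<otimes> a) \<otimes> b" using ab s c d by (simp add: m_assoc)
          also have "\<dots> = a \<otimes> (s \<otimes> b)"
            unfolding generate_commute[OF ab(1) sB, symmetric] using ab s c d by (simp add: m_assoc)
          finally show ?thesis using ab generate.eng[OF sB ab(2)] by blast
        qed
      qed
      then show "carrier W \<subseteq> (\<lambda>(a, b). a \<otimes> b) ` (?A \<times> ?B)"
        unfolding carrier_val by fastforce
    qed
    ultimately show "bij_betw (\<lambda>(a, b). a \<otimes> b) (carrier (W\<lparr>carrier := ?A\<rparr> \<times>\<times> W\<lparr>carrier := ?B\<rparr>)) (carrier W)"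
      by (simp add: bij_betw_def DirProd_def)
  qed
  then show ?thesis using sub by (simp add: internal_direct_product_def)
qed

text \<open>By \<open>retraction\<close>, words over \<open>H\<close> that agree in \<open>W\<close>
  are already equal modulo the relators on \<open>H\<close>. The subgroup is rebuilt as a plain
  \<open>monoid\<close> record, the type over which \<open>diagram_of_finite_group\<close>
  quantifies.\<close>

lemma coxeter_system_H:
  fixes G :: "'a monoid"
  defines "G \<equiv> \<lparr>carrier = generate W H, monoid.mult = (\<otimes>), one = \<one>\<rparr>"
  shows "coxeter_system G H m"
proof -
  have sub: "subgroup (generate W H) W" using generate_subgroup[OF H_S] .
  have G: "group G"
  proof (rule groupI)
    fix a assume "a \<in> carrier G"
    then have "a \<in> generate W H" by (simp add: G_def)
    then have "inv a \<in> carrier G" "inv a \<otimes>\<^bsub>G\<^esub> a = \<one>\<^bsub>G\<^esub>"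
      using sub generate_closed[OF H_S] by (auto simp: G_def subgroup.m_inv_closed)
    then show "\<exists>b \<in> carrier G. b \<otimes>\<^bsub>G\<^esub> a = \<one>\<^bsub>G\<^esub>" by blast
  qed (use generate_closed[OF H_S] in \<open>auto simp: G_def m_assoc generate.one generate.eng\<close>)
  interpret G: group G by (rule G)
  have HG: "H \<subseteq> carrier G" by (auto simp: G_def generate.incl)
  have inv_G: "inv\<^bsub>G\<^esub> h = h" if "h \<in> H" for h
    using that H_S by (intro G.inv_equality) (auto simp: G_def generate.incl)
  have wv: "word_val G u = val (map fst u) \<and> word_val W u = val (map fst u)"
    if "u \<in> lists (H \<times> UNIV)" for u
    using that
  proof (induction u rule: list.induct)
    case Nil
    then show ?case by (simp add: G_def)
  next
    case (Cons a u)
    then show ?case using inv_G H_S by (cases a) (auto simp: G_def)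
  qed
  let ?eq = "presented_eq H (coxeter_relators H m)"
  \<comment> \<open>\<open>retraction\<close> speaks of positive words, so each formal inverse is
    first replaced by its letter, using the relator \<open>h h\<close>.\<close>
  have unsign: "?eq u (map (\<lambda>s. (s, True)) (map fst u))" if "u \<in> lists (H \<times> UNIV)" for u
    using that
  proof (induction u rule: list.induct)
    case Nil
    then show ?case by (simp add: presented_eq.reflexive)
  next
    case (Cons a u)
    obtain h b where a: "a = (h, b)" by (cases a)
    have h: "h \<in> H" and u: "u \<in> lists (H \<times> UNIV)" using Cons.prems a by auto
    have "?eq [(h, False)] [(h, True)]"
    proof -
      have "?eq ([] @ [(h, True), (h, True)] @ [(h, False)]) ([] @ [] @ [(h, False)])"
        by (intro presented_eq.in_context presented_eq_square h)
      moreover have "?eq ([(h, True)] @ [(h, True), (h, \<not> True)] @ []) ([(h, True)] @ [] @ [])"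
        by (intro presented_eq.in_context presented_eq.cancel h)
      ultimately show ?thesis by (auto intro: presented_eq.intros)
    qed
    then have "?eq [(h, b)] [(h, True)]"
      by (cases b) (auto intro: presented_eq.reflexive)
    then have "?eq ([] @ [(h, b)] @ u) ([] @ [(h, True)] @ u)"
      by (rule presented_eq.in_context)
    moreover have "?eq ([(h, True)] @ u @ []) ([(h, True)] @ map (\<lambda>s. (s, True)) (map fst u) @ [])"
      using Cons.IH[OF u] by (rule presented_eq.in_context)
    ultimately show ?case using a by (auto intro: presented_eq.transitive)
  qed
  have "word_val G u = word_val G v \<longleftrightarrow> ?eq u v"
    if u: "u \<in> lists (H \<times> UNIV)" and v: "v \<in> lists (H \<times> UNIV)" for u v
  proof
    assume "?eq u v"
    then have "presented_eq S (coxeter_relators S m) u v"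
      using H_S coxeter_relators_mono[OF H_S] by (rule presented_eq_mono)
    moreover have "lists (H \<times> UNIV) \<subseteq> lists (S \<times> (UNIV :: bool set))"
      using H_S by (intro lists_mono) auto
    then have "u \<in> lists (S \<times> UNIV)" "v \<in> lists (S \<times> UNIV)"
      using u v by (simp_all add: subsetD)
    ultimately have "word_val W u = word_val W v"
      using presentation unfolding has_presentation_def by blast
    then show "word_val G u = word_val G v" using wv u v by simp
  next
    assume "word_val G u = word_val G v"
    then have "val (map fst u) = val (map fst v)" using wv u v by simp
    moreover have lists: "map fst w \<in> lists S \<and> filter (\<lambda>s. s \<in> H) (map fst w) = map fst w"
      if "w \<in> lists (H \<times> UNIV)" for w
      using that H_S by (induction w rule: list.induct) auto
    ultimately have "?eq (map (\<lambda>s. (s, True)) (map fst u)) (map (\<lambda>s. (s, True)) (map fst v))"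
      using retraction[of "map fst u" "map fst v"] lists[OF u] lists[OF v] by simp
    then show "?eq u v"
      using unsign[OF u] unsign[OF v] presented_eq.transitive presented_eq.symmetric by metis
  qed
  moreover have "generate G H = carrier G"
  proof
    show "generate G H \<subseteq> carrier G"
      using G.generate_incl[OF HG] .
    have "g \<in> generate G H" if "g \<in> generate W H" for g
      using that
    proof (induction)
      case one
      then show ?case using generate.one[of G H] by (simp add: G_def)
    next
      case (incl h)
      then show ?case by (rule generate.incl)
    next
      case (inv h)
      then show ?case using H_S generate.incl[of h H G] by auto
    next
      case (eng g h)
      then show ?case using generate.eng[of g G H h] by (simp add: G_def)
    qed
    then show "carrier G \<subseteq> generate G H" by (auto simp: G_def)
  qed
  ultimately have pres: "has_presentation G H (coxeter_relators H m)"
    using HG by (simp add: has_presentation_def)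
  show ?thesis
  proof (intro coxeter_system.intro coxeter_system_axioms.intro G pres)
    fix s t assume "s \<in> H" "t \<in> H"
    then have st: "s \<in> S" "t \<in> S" using H_S by auto
    show "1 \<le> m s t" by (rule m_pos[OF st])
    show "m s t = m t s" by (rule m_sym[OF st])
    show "m s t = 1 \<longleftrightarrow> s = t" by (rule m_one_iff[OF st])
  qed
qed

end


lemma diagram_of_finite_group_H:
  assumes "S = {x, y} \<union> H" "x \<notin> H" "y \<notin> H" "m x y = \<infinity>" "\<And>h. h \<in> H \<Longrightarrow> m x h = 2 \<and> m y h = 2"
    and "finite (generate W H)"
  shows "diagram_of_finite_group (presentation_diagram H m)"
proof -
  have "verts (presentation_diagram H m) = H" by (simp add: presentation_diagram_def)
  then show ?thesis
    unfolding diagram_of_finite_group_def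
    using coxeter_system_H[OF assms(1-5)] assms(6)
    by (intro exI[of _ "\<lparr>carrier = generate W H, monoid.mult = (\<otimes>), one = \<one>\<rparr>"] exI[of _ m]) simp
qed

section \<open>The Cayley graph of the product as a thickened line\<close>

lemma unrelated_int_pow_eq_one:
  assumes st: "s \<in> S" "t \<in> S" and inf: "m s t = \<infinity>" and eq: "(s \<otimes> t) [^] (k :: int) = \<one>"
  shows "k = 0"
proof -
  have p: "s \<otimes> t \<in> carrier W" using st by simp
  have "(s \<otimes> t) [^] nat \<bar>k\<bar> = \<one>"
  proof (cases "0 \<le> k")
    case True
    then show ?thesis using eq int_pow_int[of W "s \<otimes> t" "nat k"] by simp
  next
    case False
    then have "(s \<otimes> t) [^] (- k) = \<one>" using int_pow_neg[OF p, of k] eq by simp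
    then show ?thesis using False int_pow_int[of W "s \<otimes> t" "nat (- k)"] by simp
  qed
  then show ?thesis using unrelated_infinite_order[OF st inf, of "nat \<bar>k\<bar>"] by auto
qed

lemma even_len_int_pow:
  assumes st: "s \<in> S" "t \<in> S"
  shows "even (len ((s \<otimes> t) [^] (k :: int)))"
proof (cases "0 \<le> k")
  case True
  then show ?thesis using even_len_pow[OF st, of "nat k"] int_pow_int[of W "s \<otimes> t" "nat k"] by simp
next
  case False
  have p: "s \<otimes> t \<in> carrier W" using st by simp
  have "even (len ((s \<otimes> t) [^] (- k)))"
    using False even_len_pow[OF st, of "nat (- k)"] int_pow_int[of W "s \<otimes> t" "nat (- k)"] by simp
  then show ?thesis using int_pow_neg[OF p, of k] p by simp
qed

text \<open>Multiplication is a homomorphism on the product; evaluate it on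
  \<open>(\<one>, b)\<close> times \<open>(a, \<one>)\<close>.\<close>

lemma internal_direct_product_commute:
  assumes "internal_direct_product W A B" "a \<in> A" "b \<in> B"
  shows "a \<otimes> b = b \<otimes> a"
proof -
  let ?P = "W\<lparr>carrier := A\<rparr> \<times>\<times> W\<lparr>carrier := B\<rparr>"
  have sub: "subgroup A W" "subgroup B W" and hom: "(\<lambda>(a, b). a \<otimes> b) \<in> hom ?P W"
    using assms(1) by (auto simp: internal_direct_product_def iso_def)
  have c: "a \<in> carrier W" "b \<in> carrier W" "\<one> \<in> A" "\<one> \<in> B"
    using subgroup.mem_carrier[OF sub(1) assms(2)] subgroup.mem_carrier[OF sub(2) assms(3)]
      subgroup.one_closed[OF sub(1)] subgroup.one_closed[OF sub(2)] by simp_all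
  have "(\<lambda>(a, b). a \<otimes> b) ((\<one>, b) \<otimes>\<^bsub>?P\<^esub> (a, \<one>)) = (\<one> \<otimes> b) \<otimes> (a \<otimes> \<one>)"
    using hom_mult[OF hom, of "(\<one>, b)" "(a, \<one>)"] assms c by (simp add: DirProd_def)
  then show ?thesis using c by (simp add: DirProd_def)
qed

text \<open>The whole finite factor is put into the generating set, so each element of the fibre
  \<open>c n <H>\<close> equals or is adjacent to \<open>c n\<close>. The generators
  \<open>x\<close> and \<open>y\<close> commute with the finite factor and move the height by one,
  as \<open>line_two_ends\<close> asks.\<close>

lemma two_ended_of_product:
  assumes S_eq: "{x, y} \<union> H = S" and unrel: "m x y = \<infinity>" and fin: "finite (generate W H)"
    and prod: "internal_direct_product W (generate W {x, y}) (generate W H)"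
  shows "two_ended W"
proof -
  let ?A = "generate W {x, y}" and ?B = "generate W H"
  have x: "x \<in> S" and y: "y \<in> S" and xyS: "{x, y} \<subseteq> S" and H: "H \<subseteq> S" using S_eq by auto
  have subA: "subgroup ?A W" and subB: "subgroup ?B W"
    using generate_subgroup[OF xyS] generate_subgroup[OF H] .
  have Ac: "a \<in> carrier W" if "a \<in> ?A" for a using generate_closed[OF xyS that] .
  have Bc: "b \<in> carrier W" if "b \<in> ?B" for b using generate_closed[OF H that] .
  let ?p = "x \<otimes> y"
  have p: "?p \<in> carrier W" using x y by simp
  \<comment> \<open>The alternating words in their order along the line:
    \<open>1, x, x y, x y x, ...\<close> for \<open>n \<ge> 0\<close> and
    \<open>y, y x, y x y, ...\<close> for \<open>n = -1, -2, -3, ...\<close>. Floor division lets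
    one formula serve both directions.\<close>
  define c where "c = (\<lambda>n :: int. ?p [^] (n div 2) \<otimes> (if even n then \<one> else x))"
  have cc [simp]: "c n \<in> carrier W" for n using p x by (simp add: c_def)
  have c_even: "c (n + 1) = c n \<otimes> x" if "even n" for n
    using that p x by (auto simp: c_def elim!: evenE)
  have c_odd: "c (n + 1) = c n \<otimes> y" if n: "odd n" for n
  proof -
    obtain k where k: "n = 2 * k + 1" using n by (rule oddE)
    have "c (n + 1) = ?p [^] (k + 1)" using p by (simp add: c_def k add.commute)
    also have "\<dots> = ?p [^] k \<otimes> ?p" using int_pow_mult[OF p, of k 1] p by simp
    also have "\<dots> = c n \<otimes> y" using p x y by (simp add: c_def k m_assoc)
    finally show ?thesis .
  qed
  have c_mult: "c n \<otimes> s \<in> {c (n + 1), c (n - 1)}" if "s \<in> {x, y}" for n s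
    using that c_even[of n] c_odd[of n] c_even[of "n - 1"] c_odd[of "n - 1"] x y
    by (cases "even n") auto
  have c_A: "c n \<in> ?A" for n
  proof -
    have "?p \<in> ?A" by (intro generate.eng generate.incl) auto
    then have "?p [^] (k :: int) \<in> ?A" for k using subgroup_int_pow_closed[OF subA] by blast
    then show ?thesis
      unfolding c_def by (intro generate.eng) (auto intro: generate.one generate.incl)
  qed
  have c_inj: "i = j" if eq: "c i = c j" for i j
  proof -
    \<comment> \<open>Rotations have even and reflections odd length, so equal values force indices
      of equal parity. The rotations then differ by a power of \<open>x y\<close> equal to
      \<open>1\<close>, whose exponent is 0.\<close>
    have par: "even (len (c n)) \<longleftrightarrow> even n" for n
      using len_parity[of "?p [^] (n div 2)" x] even_len_int_pow[OF x y, of "n div 2"] p x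
      by (auto simp: c_def)
    then have par_eq: "even i \<longleftrightarrow> even j" using eq by metis
    then have "?p [^] (i div 2) = ?p [^] (j div 2)"
      using eq p x by (auto simp: c_def split: if_splits)
    then have "?p [^] (i div 2 - j div 2) = \<one>"
      using p by (simp add: int_pow_diff)
    then have "i div 2 = j div 2" using unrelated_int_pow_eq_one[OF x y unrel] by fastforce
    then show ?thesis using par_eq by (metis even_iff_mod_2_eq_zero odd_iff_mod_2_eq_one mult_div_mod_eq)
  qed
  have "\<exists>n. val u = c n" if "u \<in> lists {x, y}" for u
    using that
  proof (induction u rule: rev_induct)
    case Nil
    have "val [] = c 0" by (simp add: c_def)
    then show ?case by blast
  next
    case (snoc s u)
    then obtain n where n: "val u = c n" and s: "s \<in> {x, y}" and u: "u \<in> lists {x, y}" by auto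
    have "u \<in> lists S" using u lists_mono[OF xyS] by blast
    moreover have "s \<in> S" using s x y by blast
    ultimately have "val (u @ [s]) = c n \<otimes> s" using val_append[of u "[s]"] n by simp
    then show ?case using c_mult[OF s, of n] by auto
  qed
  then have A_c: "\<exists>n. a = c n" if "a \<in> ?A" for a
    using that unfolding generate_val[OF xyS] by (metis imageE)
  have bij: "bij_betw (\<lambda>(a, b). a \<otimes> b) (?A \<times> ?B) (carrier W)"
    using prod by (auto simp: internal_direct_product_def iso_def DirProd_def)
  have decomp: "\<exists>n. \<exists>f \<in> ?B. w = c n \<otimes> f" if "w \<in> carrier W" for w
  proof -
    have "w \<in> (\<lambda>(a, b). a \<otimes> b) ` (?A \<times> ?B)" using bij that by (simp add: bij_betw_def)
    then obtain a b where "a \<in> ?A" "b \<in> ?B" "w = a \<otimes> b" by auto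
    then show ?thesis using A_c by metis
  qed
  have unique: "n = k" if "c n \<otimes> f = c k \<otimes> g" "f \<in> ?B" "g \<in> ?B" for n k f g
  proof -
    have "(c n, f) = (c k, g)"
      using bij_betw_imp_inj_on[OF bij] that c_A by (auto dest!: inj_onD[where x = "(c n, f)" and y = "(c k, g)"])
    then show ?thesis using c_inj by simp
  qed
  define h where "h = (\<lambda>w. THE n. \<exists>f \<in> ?B. w = c n \<otimes> f)"
  have h_eq: "h (c n \<otimes> f) = n" if "f \<in> ?B" for n f
    unfolding h_def using unique that by (intro the_equality) blast+
  have h_c: "h (c n) = n" for n
    using h_eq[OF generate.one, of n] by simp
  define X where "X = {x, y} \<union> ?B"
  have X: "finite X" "X \<subseteq> carrier W" using fin x y Bc by (auto simp: X_def)
  have "S \<subseteq> X" using S_eq generate.incl[of _ H W] by (auto simp: X_def)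
  then have "generate W S \<subseteq> generate W X" by (rule mono_generate)
  then have gen: "generate W X = carrier W" using generate_S generate_incl[OF X(2)] by auto
  let ?E = "cayley_edges W X"
  note edge = cayley_edges_iff[OF X(2)]
  have swap: "c n \<otimes> f \<otimes> s = c n \<otimes> s \<otimes> f" if "f \<in> ?B" "s \<in> {x, y}" for n f s
  proof -
    have "s \<otimes> f = f \<otimes> s"
      using internal_direct_product_commute[OF prod generate.incl[OF that(2)] that(1)] .
    then show ?thesis using Bc[OF that(1)] that(2) x y by (auto simp: m_assoc)
  qed
  have "card (graph_ends ?E) = 2"
  proof (rule line_two_ends[OF sym_cayley_edges cayley_edges_carrier, where h = h and c = c])
    show "finite {v \<in> carrier W. h v = n}" for n
    proof (rule finite_subset)
      show "{v \<in> carrier W. h v = n} \<subseteq> (\<lambda>f. c n \<otimes> f) ` ?B" using decomp h_eq by fastforce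
      show "finite ((\<lambda>f. c n \<otimes> f) ` ?B)" using fin by simp
    qed
  next
    fix u v assume "(u, v) \<in> ?E"
    then obtain z where u: "u \<in> carrier W" and z: "z \<in> X" and v: "v = u \<otimes> z \<or> v = u \<otimes> inv z"
      unfolding edge by blast
    obtain n f where nf: "f \<in> ?B" "u = c n \<otimes> f" using decomp[OF u] by blast
    show "\<bar>h u - h v\<bar> \<le> 1"
    proof (cases "z \<in> ?B")
      case True
      then have "\<exists>g \<in> ?B. v = c n \<otimes> g"
      proof -
        have "f \<otimes> z \<in> ?B" "f \<otimes> inv z \<in> ?B"
          using nf True subB by (simp_all add: subgroup.m_closed subgroup.m_inv_closed)
        then show ?thesis using v nf Bc[OF nf(1)] Bc[OF True] by (auto simp: m_assoc)
      qed
      then show ?thesis using h_eq nf by auto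
    next
      case False
      then have zxy: "z \<in> {x, y}" using z by (simp add: X_def)
      then have "v = c n \<otimes> z \<otimes> f" using v nf swap[OF nf(1) zxy] x y by auto
      then have "h v = n + 1 \<or> h v = n - 1" using c_mult[OF zxy, of n] h_eq[OF nf(1)] by auto
      then show ?thesis using h_eq[OF nf(1)] nf(2) by auto
    qed
  next
    show "h (c n) = n" for n by (rule h_c)
    show "(c n, c (n + 1)) \<in> ?E" for n
      unfolding edge using c_even[of n] c_odd[of n] by (cases "even n") (auto simp: X_def)
  next
    fix v assume "v \<in> carrier W"
    then obtain n f where nf: "f \<in> ?B" "v = c n \<otimes> f" using decomp by blast
    have "c n = v \<otimes> inv f" using nf Bc[OF nf(1)] by (simp add: m_assoc)
    then have "(v, c n) \<in> ?E"
      unfolding edge using nf(1) \<open>v \<in> carrier W\<close> by (auto simp: X_def)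
    moreover have "h v = n" using h_eq nf by simp
    ultimately show "(v, c (h v)) \<in> joined ?E {w. h w = h v}"
      using h_c by (auto simp: joined_def)
  qed
  then show ?thesis
    using X gen unfolding two_ended_def by blast
qed

end

section \<open>Equivalence of the 2-ended, diagram and product conditions\<close>

theorem corollary17:
  fixes W :: "('a, 'b) monoid_scheme" and S :: "'a set" and m :: "'a \<Rightarrow> 'a \<Rightarrow> enat"
  assumes "coxeter_system W S m"
  defines "\<Gamma> \<equiv> presentation_diagram S m"
  shows "(two_ended W \<longleftrightarrow>
            (\<exists>\<Gamma>0. subdiagram \<Gamma>0 \<Gamma> \<and> separates \<Gamma>0 \<Gamma> \<and> diagram_of_finite_group \<Gamma>0 \<and>
              (\<exists>x y. x \<noteq> y \<and> verts (diagram_diff \<Gamma> \<Gamma>0) = {x, y} \<and>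
                 (\<forall>v \<in> verts \<Gamma>0. label \<Gamma> x v = Some 2 \<and> label \<Gamma> y v = Some 2) \<and>
                 label \<Gamma> x y = None)))
       \<and> (two_ended W \<longleftrightarrow>
            (\<exists>x y H. {x, y} \<union> H = S \<and> unrelated m x y \<and> finite (generate W H) \<and>
               internal_direct_product W (generate W {x, y}) (generate W H)))"
    (is "(_ \<longleftrightarrow> ?diagram) \<and> (_ \<longleftrightarrow> ?product)")
proof -
  interpret coxeter_system W S m by (rule assms)
  have verts: "verts \<Gamma> = S" by (simp add: \<Gamma>_def presentation_diagram_def)
  have label_two: "label \<Gamma> s t = Some 2 \<longleftrightarrow> m s t = 2" if "s \<in> S" "t \<in> S" "s \<noteq> t" for s t
    using that by (cases "m s t") (auto simp: \<Gamma>_def presentation_diagram_def numeral_eq_enat)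
  have label_None: "label \<Gamma> s t = None \<longleftrightarrow> m s t = \<infinity>" if "s \<in> S" "t \<in> S" "s \<noteq> t" for s t
    using that by (auto simp: \<Gamma>_def presentation_diagram_def)
  have label_same: "label \<Gamma> s s = None" for s
    by (simp add: \<Gamma>_def presentation_diagram_def)
  have induced: "induced \<Gamma> T = presentation_diagram T n"
    if "T \<subseteq> S" "\<And>s t. s \<in> T \<Longrightarrow> t \<in> T \<Longrightarrow> n s t = m s t" for T n
    using that by (auto simp: \<Gamma>_def induced_def presentation_diagram_def fun_eq_iff)
  have diagram: ?diagram if W: "two_ended W"
  proof -
    obtain x y D where S: "S = {x, y} \<union> D" and xy: "x \<noteq> y" "x \<notin> D" "y \<notin> D" and inf: "m x y = \<infinity>"
      and fin: "finite (generate W D)" and two: "\<forall>d \<in> D. m x d = 2 \<and> m y d = 2"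
      using two_ended_structure[OF W] by blast
    have sub: "D \<subseteq> S" and xyS: "x \<in> S" "y \<in> S" using S by auto
    let ?G0 = "induced \<Gamma> D"
    have G0: "?G0 = presentation_diagram D m" using induced[OF sub] by simp
    have v0: "verts ?G0 = D" using sub verts by (auto simp: induced_def)
    have diff: "diagram_diff \<Gamma> ?G0 = induced \<Gamma> {x, y}"
    proof -
      have "verts \<Gamma> - D = {x, y}" using verts S xy by auto
      then show ?thesis by (simp add: diagram_diff_def v0)
    qed
    have vdiff: "verts (diagram_diff \<Gamma> ?G0) = {x, y}"
      unfolding diff using xyS verts by (auto simp: induced_def)
    have none: "label \<Gamma> x y = None" "label \<Gamma> y x = None"
      using label_None xyS xy inf m_sym by auto
    have "diagram_edges (diagram_diff \<Gamma> ?G0) = {}"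
      unfolding diagram_edges_def vdiff unfolding diff using none label_same by (auto simp: induced_def)
    then have "joined (diagram_edges (diagram_diff \<Gamma> ?G0)) {x, y} = {(x, x), (y, y)}"
      by (auto simp: joined_def)
    then have "diagram_components (diagram_diff \<Gamma> ?G0) = {{x}, {y}}"
      unfolding diagram_components_def vdiff using xy by (auto simp: quotient_def)
    then have "separates ?G0 \<Gamma>" using xy unfolding separates_def by auto
    moreover have "diagram_of_finite_group ?G0"
      unfolding G0 using diagram_of_finite_group_H[OF S xy(2,3) inf _ fin] two by blast
    moreover have "subdiagram ?G0 \<Gamma>" unfolding subdiagram_def using sub verts by blast
    moreover have "\<forall>v \<in> verts ?G0. label \<Gamma> x v = Some 2 \<and> label \<Gamma> y v = Some 2"
      unfolding v0 using label_two two sub xyS xy by (metis subsetD)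
    ultimately show ?diagram using xy(1) vdiff none(1) by blast
  qed
  have product: ?product if ?diagram
  proof -
    obtain \<Gamma>0 x y where sub: "subdiagram \<Gamma>0 \<Gamma>" and fin: "diagram_of_finite_group \<Gamma>0"
      and xy: "x \<noteq> y" and diff: "verts (diagram_diff \<Gamma> \<Gamma>0) = {x, y}"
      and two: "\<forall>v \<in> verts \<Gamma>0. label \<Gamma> x v = Some 2 \<and> label \<Gamma> y v = Some 2"
      and none: "label \<Gamma> x y = None"
      using \<open>?diagram\<close> by blast
    obtain H where H: "H \<subseteq> S" "\<Gamma>0 = induced \<Gamma> H" using sub verts unfolding subdiagram_def by blast
    have v0: "verts \<Gamma>0 = H" using H verts by (auto simp: induced_def)
    have "S - H = {x, y}" using diff v0 verts by (auto simp: diagram_diff_def induced_def)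
    then have S: "S = {x, y} \<union> H" and xyH: "x \<notin> H" "y \<notin> H" using H by auto
    then have xyS: "x \<in> S" "y \<in> S" by auto
    have inf: "m x y = \<infinity>" using none label_None xyS xy by blast
    have mtwo: "m x h = 2 \<and> m y h = 2" if "h \<in> H" for h
      using two that label_two[of x h] label_two[of y h] xyS xyH H v0 by auto
    obtain G :: "'a monoid" and n where G: "coxeter_system G H n"
      and eq: "\<Gamma>0 = presentation_diagram H n" and finG: "finite (carrier G)"
      using fin unfolding diagram_of_finite_group_def v0 by blast
    \<comment> \<open>Off the diagonal, equal labels give equal finite values, and a missing edge
      means \<open>\<infinity>\<close> for both. On the diagonal the diagram carries no label, and
      the axioms make both values 1.\<close>
    have "n s t = m s t" if st: "s \<in> H" "t \<in> H" for s t
    proof (cases "s = t")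
      case True
      have "n s t = 1" using coxeter_system.m_one_iff[OF G st] True by simp
      moreover have "m s t = 1" using m_one_iff True st H by auto
      ultimately show ?thesis by simp
    next
      case False
      have "\<Gamma>0 = presentation_diagram H m" using induced[OF H(1)] H(2) by simp
      then have "label (presentation_diagram H n) s t = label (presentation_diagram H m) s t"
        using eq by simp
      then show ?thesis
        using False st by (cases "n s t"; cases "m s t") (auto simp: presentation_diagram_def)
    qed
    then have "finite (generate W H)"
      using finite_generate_of_finite_group[OF G H(1) _ finG] by blast
    moreover have "internal_direct_product W (generate W {x, y}) (generate W H)"
      using product_decomposition[OF S xyH inf mtwo] .
    ultimately show ?product
      using S inf unfolding unrelated_def by blast
  qed
  have "two_ended W" if ?product
    using that two_ended_of_product unfolding unrelated_def by blast
  then show ?thesis using diagram product by blast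
qed

end
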